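(* Assume (H1), (H2), (H3) (stated in the context). Let $(C,\mathfrak{c})=(A,\mathfrak{a})$ or $(C,\mathfrak{c})=(B,\mathfrak{b})$ and let $\xi\in\mathcal{H}$. If $\lambda\in\mathbb{R}\setminus\sigma_0^{\mathfrak{c}}$, then the solution $\eta=(\eta(0),\dots,\eta(\bar T))\in\mathcal{H}$ of the lower triangular system $$\sum_{0\le l\le k}C^0(k,l)\eta(l)=\xi^0(k),\qquad 0\le k\le\bar T,$$ is successively given by $$\eta(k)=(C^k(k,k))^{-1}\Big(\xi^0(k)-\sum_{0\le l\le k-1}C^0(k,l)\eta(l)\Big),\qquad 0\le k\le\bar T$$ (the sum being absent for $k=0$).
   Context: Let $(\Omega,\mathcal{F},P)$ be a probability space with a filtration $(\mathcal{F}_t)_{t\in\mathbb{N}}$, $\mathcal{F}_0=\{\Omega,\emptyset\}$. Fix integers $N\ge1$, $\bar T\ge1$. For $0\le k\le\bar T$ let $u^\infty(k)=(u^\infty_1(k),\dots,u^\infty_N(k))$ be an $\mathbb{R}^N$-valued random variable with finite moments of all orders, measurable with respect to $\mathcal{F}_{\bar T+T}$ for a fixed integer $T\ge0$. Let $\mathcal{H}_k=L^2(\Omega,\mathcal{F}_k,P;\mathbb{R}^N)$ and $\mathcal{H}=\bigoplus_{0\le k\le\bar T}\mathcal{H}_k$ (elements $\eta=(\eta(k))_{0\le k\le \bar T}$). Hypotheses: (H1) $u^\infty(k)$ is independent of $\mathcal{F}_k$ for $0\le k\le\bar T$. (H2) For each $k$ the covariance matrix of $u^\infty(k)$ is positive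 definite. (H3) For all $i,j$ and $k\ne l$, $u_i^\infty(k)$ and $u_j^\infty(l)$ are independent. Operators $\mathcal{H}_l\to\mathcal{H}_k$: $A(k,l)\eta(l)=E(u^\infty(k)(u^\infty(l)\cdot\eta(l))\mid\mathcal{F}_k)$ and $B(k,l)\eta(l)=E(u^\infty(k)(u^\infty(l)\cdot\eta(l)-E(u^\infty(l)\cdot\eta(l)))\mid\mathcal{F}_k)$; $C(k,l)$ denotes $A(k,l)$ or $B(k,l)$ according to the case. Matrices ($1\le i,j\le N$): $M^{\mathfrak{a}}_{ij}(k)=E(u_i^\infty(k)u_j^\infty(k))$, $M^{\mathfrak{b}}(k)$ is the covariance matrix of $u^\infty(k)$, $(N_n^{\mathfrak{a}}(k))_{ij}=E\big(E(u_i^\infty(k)|\mathcal{F}_n)E(u_j^\infty(k)|\mathcal{F}_n)\big)$, and $(N_n^{\mathfrak{b}}(k))_{ij}=(N_n^{\mathfrak{a}}(k))_{ij}-E(u_i^\infty(k))E(u_j^\infty(k))$. Recursion (depending on $\lambda\in\mathbb{R}$). Start: $D_{\bar T}(k)=M^{\mathfrak{a}}(k)-\lambda$ ($0\le k\le\bar T$), $f_{\bar T}=1$, $g_{\bar T}=0$. For $n$ decreasing from $\bar T$, as long as $D_n(n)$ is invertible: $d_n=E(u^\infty(n))\cdot\big(D_n(n)^{-1}E(u^\infty(n))\big)$, and for $n\ge1$: $f_{n-1}=f_n(1-d_nf_n)$, $g_{n-1}=g_n+d_nf_n^2$, $D_{n-1}(k)=D_n(k)-d_nf_n^2N_n^{\mathfrak{a}}(k)$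 for $0\le k\le n-1$. Thus $D_n(k)=M^{\mathfrak{a}}(k)-\sum_{n+1\le r\le\bar T}d_rf_r^2N_r^{\mathfrak{a}}(k)-\lambda$. Exceptional sets: $\sigma^{\mathfrak{a}}_{\bar T+1}=\sigma^{\mathfrak{b}}_{\bar T+1}=\emptyset$ and, for $0\le n\le\bar T$, $\sigma_n^{\mathfrak{a}}$ is the union of $\sigma_{n+1}^{\mathfrak{a}}$ and the set of $\lambda\in\mathbb{R}\setminus\sigma_{n+1}^{\mathfrak{a}}$ that are eigenvalues of $M^{\mathfrak{a}}(n)-\sum_{n+1\le r\le\bar T}d_rf_r^2N_r^{\mathfrak{a}}(n)$ (with $d_r,f_r$ evaluated at that $\lambda$); $\sigma_n^{\mathfrak{b}}$ is the union of $\sigma_{n+1}^{\mathfrak{b}}$, $\sigma_n^{\mathfrak{a}}$ and the set of $\lambda\in\mathbb{R}\setminus\sigma_{n+1}^{\mathfrak{a}}$ that are eigenvalues of $M^{\mathfrak{b}}(n)-\sum_{n+1\le r\le\bar T}d_rf_r^2N_r^{\mathfrak{b}}(n)$ (evaluated at that $\lambda$). Operators $C^n(k,l):\mathcal{H}_l\to\mathcal{H}_k$ ($0\le k,l\le\bar T$): $C^{\bar T}(k,l)=C(k,l)$ for $k\ne l$ and $C^{\bar T}(k,k)=C(k,k)-\lambda I$. For $0<n\le\bar T$ (with $D_n(n)$ invertible): $C^{n-1}(k,l)=C^n(k,l)$ for $n\le k\le\bar T$, $0\le l\le\bar T$; $C^{n-1}(k,l)=0$ for $0\le k<n\le l\le\bar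 T$; $C^{n-1}(k,l)=f_{n-1}C(k,l)$ for $k\neq l$, $0\le k,l<n$; and for $0\le k<n$, in the case $C=A$: $C^{n-1}(k,k)\eta(k)=D_{n-1}(k)\eta(k)$, and in the case $C=B$: $C^{n-1}(k,k)\eta(k)=D_{n-1}(k)\eta(k)-(1-g_{n-1})E(u^\infty(k))\,(E(u^\infty(k))\cdot E(\eta(k)))$. Right-hand sides: $\xi^{\bar T}=\xi$, and for $0<n\le\bar T$: $\xi^{n-1}(k)=\xi^n(k)$ for $n\le k\le\bar T$, $\xi^{n-1}(k)=\xi^n(k)-C^n(k,n)(C^n(n,n))^{-1}\xi^n(n)$ for $0\le k<n$ (when $C^n(n,n)$ has a bounded inverse). *)

theory Defs
  imports "HOL-Probability.Probability"
begin

section \<open>Square integrable random vectors and bounded operators\<close>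

text \<open>
  Elements of the Hilbert space $L^2(\Omega, G, P; R^N)$ are represented by $G$-measurable
  square integrable functions; equality of elements is equality almost everywhere.
  Accordingly, operators between such spaces act on functions, and all operator identities are
  understood modulo null sets. The dimension $N$ is the cardinality of the index type.
\<close>

definition L2 :: "'a measure \<Rightarrow> 'a measure \<Rightarrow> ('a \<Rightarrow> real ^ 'n) set" where
  "L2 M G = {f \<in> borel_measurable G. integrable M (\<lambda>x. (norm (f x))\<^sup>2)}"

definition L2_norm :: "'a measure \<Rightarrow> ('a \<Rightarrow> real ^ 'n) \<Rightarrow> real" where
  "L2_norm M f = sqrt (\<integral>x. (norm (f x))\<^sup>2 \<partial>M)"

definition L2_eq :: "'a measure \<Rightarrow> ('a \<Rightarrow> real ^ 'n) \<Rightarrow> ('a \<Rightarrow> real ^ 'n) \<Rightarrow> bool" where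
  "L2_eq M f g \<longleftrightarrow> (AE x in M. f x = g x)"

text \<open>
  Compatibility of a bounded operator with \<open>L2_eq\<close> need not be required separately: it
  follows from additivity and the norm bound, applied to the difference of two representatives.
\<close>

definition bounded_op ::
  "'a measure \<Rightarrow> 'a measure \<Rightarrow> (('a \<Rightarrow> real ^ 'n) \<Rightarrow> ('a \<Rightarrow> real ^ 'n)) \<Rightarrow> bool" where
  "bounded_op M G S \<longleftrightarrow>
     (\<forall>f\<in>L2 M G. S f \<in> L2 M G) \<and>
     (\<forall>f\<in>L2 M G. \<forall>g\<in>L2 M G. L2_eq M (S (\<lambda>x. f x + g x)) (\<lambda>x. S f x + S g x)) \<and>
     (\<forall>a. \<forall>f\<in>L2 M G. L2_eq M (S (\<lambda>x. a *\<^sub>R f x)) (\<lambda>x. a *\<^sub>R S f x)) \<and>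
     (\<exists>K. \<forall>f\<in>L2 M G. L2_norm M (S f) \<le> K * L2_norm M f)"

definition is_bounded_inverse ::
  "'a measure \<Rightarrow> 'a measure \<Rightarrow> (('a \<Rightarrow> real ^ 'n) \<Rightarrow> ('a \<Rightarrow> real ^ 'n)) \<Rightarrow>
   (('a \<Rightarrow> real ^ 'n) \<Rightarrow> ('a \<Rightarrow> real ^ 'n)) \<Rightarrow> bool" where
  "is_bounded_inverse M G S R \<longleftrightarrow>
     bounded_op M G S \<and> bounded_op M G R \<and>
     (\<forall>f\<in>L2 M G. L2_eq M (R (S f)) f \<and> L2_eq M (S (R f)) f)"

definition has_bounded_inverse ::
  "'a measure \<Rightarrow> 'a measure \<Rightarrow> (('a \<Rightarrow> real ^ 'n) \<Rightarrow> ('a \<Rightarrow> real ^ 'n)) \<Rightarrow> bool" where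
  "has_bounded_inverse M G S \<longleftrightarrow> (\<exists>R. is_bounded_inverse M G S R)"

text \<open>
  The inverse operator; on \<open>L2 M G\<close> its values are unique up to \<open>L2_eq M\<close> whenever
  \<open>has_bounded_inverse M G S\<close>, and it is unspecified otherwise.
\<close>

definition op_inverse ::
  "'a measure \<Rightarrow> 'a measure \<Rightarrow> (('a \<Rightarrow> real ^ 'n) \<Rightarrow> ('a \<Rightarrow> real ^ 'n)) \<Rightarrow>
   (('a \<Rightarrow> real ^ 'n) \<Rightarrow> ('a \<Rightarrow> real ^ 'n))" where
  "op_inverse M G S = (SOME R. is_bounded_inverse M G S R)"

definition vec_cond_exp ::
  "'a measure \<Rightarrow> 'a measure \<Rightarrow> ('a \<Rightarrow> real ^ 'n) \<Rightarrow> ('a \<Rightarrow> real ^ 'n)" where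
  "vec_cond_exp M G f = (\<lambda>x. \<chi> i. real_cond_exp M G (\<lambda>y. f y $ i) x)"


section \<open>Matrices\<close>

definition pos_definite :: "real ^ 'n ^ 'n \<Rightarrow> bool" where
  "pos_definite Q \<longleftrightarrow> transpose Q = Q \<and> (\<forall>v. v \<noteq> 0 \<longrightarrow> 0 < v \<bullet> (Q *v v))"

definition is_eigenvalue :: "real ^ 'n ^ 'n \<Rightarrow> real \<Rightarrow> bool" where
  "is_eigenvalue Q lam \<longleftrightarrow> (\<exists>v. v \<noteq> 0 \<and> Q *v v = lam *\<^sub>R v)"

datatype op_case = OpA | OpB

definition mean_vec :: "'a measure \<Rightarrow> (nat \<Rightarrow> 'a \<Rightarrow> real ^ 'n) \<Rightarrow> nat \<Rightarrow> real ^ 'n" where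
  "mean_vec M u k = (\<integral>x. u k x \<partial>M)"

definition Ma :: "'a measure \<Rightarrow> (nat \<Rightarrow> 'a \<Rightarrow> real ^ 'n) \<Rightarrow> nat \<Rightarrow> real ^ 'n ^ 'n" where
  "Ma M u k = (\<chi> i j. \<integral>x. u k x $ i * u k x $ j \<partial>M)"

definition Mb :: "'a measure \<Rightarrow> (nat \<Rightarrow> 'a \<Rightarrow> real ^ 'n) \<Rightarrow> nat \<Rightarrow> real ^ 'n ^ 'n" where
  "Mb M u k = (\<chi> i j. \<integral>x. (u k x $ i - (\<integral>y. u k y $ i \<partial>M)) * (u k x $ j - (\<integral>y. u k y $ j \<partial>M)) \<partial>M)"

definition Na ::
  "'a measure \<Rightarrow> (nat \<Rightarrow> 'a measure) \<Rightarrow> (nat \<Rightarrow> 'a \<Rightarrow> real ^ 'n) \<Rightarrow> nat \<Rightarrow> nat \<Rightarrow> real ^ 'n ^ 'n" where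
  "Na M F u n k =
     (\<chi> i j. \<integral>x. real_cond_exp M (F n) (\<lambda>y. u k y $ i) x *
                 real_cond_exp M (F n) (\<lambda>y. u k y $ j) x \<partial>M)"

definition Nb ::
  "'a measure \<Rightarrow> (nat \<Rightarrow> 'a measure) \<Rightarrow> (nat \<Rightarrow> 'a \<Rightarrow> real ^ 'n) \<Rightarrow> nat \<Rightarrow> nat \<Rightarrow> real ^ 'n ^ 'n" where
  "Nb M F u n k =
     (\<chi> i j. Na M F u n k $ i $ j - (\<integral>y. u k y $ i \<partial>M) * (\<integral>y. u k y $ j \<partial>M))"


section \<open>The recursion\<close>

text \<open>
  The recursion runs downwards in \<open>n\<close> from \<open>Tbar\<close>. It is totalised: for \<open>n > Tbar\<close> the start
  values are returned, and if \<open>D\<^sub>n(n)\<close> is singular, \<open>matrix_inv\<close> is unspecified.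
  Only values at parameters \<open>lam\<close> for which all relevant \<open>D\<^sub>n(n)\<close> are invertible matter;
  this is what the exceptional sets below express.
\<close>

function
  rec_D :: "'a measure \<Rightarrow> (nat \<Rightarrow> 'a measure) \<Rightarrow> (nat \<Rightarrow> 'a \<Rightarrow> real ^ 'n) \<Rightarrow> nat \<Rightarrow> real \<Rightarrow>
            nat \<Rightarrow> nat \<Rightarrow> real ^ 'n ^ 'n"
and
  rec_d :: "'a measure \<Rightarrow> (nat \<Rightarrow> 'a measure) \<Rightarrow> (nat \<Rightarrow> 'a \<Rightarrow> real ^ 'n) \<Rightarrow> nat \<Rightarrow> real \<Rightarrow> nat \<Rightarrow> real"
and
  rec_f :: "'a measure \<Rightarrow> (nat \<Rightarrow> 'a measure) \<Rightarrow> (nat \<Rightarrow> 'a \<Rightarrow> real ^ 'n) \<Rightarrow> nat \<Rightarrow> real \<Rightarrow> nat \<Rightarrow> real"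
where
  "rec_D M F u Tbar lam n k =
     (if Tbar \<le> n then Ma M u k - mat lam
      else rec_D M F u Tbar lam (Suc n) k -
           (rec_d M F u Tbar lam (Suc n) * (rec_f M F u Tbar lam (Suc n))\<^sup>2) *\<^sub>R Na M F u (Suc n) k)"
| "rec_d M F u Tbar lam n =
     mean_vec M u n \<bullet> (matrix_inv (rec_D M F u Tbar lam n n) *v mean_vec M u n)"
| "rec_f M F u Tbar lam n =
     (if Tbar \<le> n then 1
      else rec_f M F u Tbar lam (Suc n) *
           (1 - rec_d M F u Tbar lam (Suc n) * rec_f M F u Tbar lam (Suc n)))"
  by pat_completeness auto
termination
  by (relation "Wellfounded.measure (\<lambda>p. case p of
        Inl (M, F, u, Tbar, lam, n, k) \<Rightarrow> 2 * (Tbar - n)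
      | Inr (Inl (M, F, u, Tbar, lam, n)) \<Rightarrow> 2 * (Tbar - n) + 1
      | Inr (Inr (M, F, u, Tbar, lam, n)) \<Rightarrow> 2 * (Tbar - n))") auto

function
  rec_g :: "'a measure \<Rightarrow> (nat \<Rightarrow> 'a measure) \<Rightarrow> (nat \<Rightarrow> 'a \<Rightarrow> real ^ 'n) \<Rightarrow> nat \<Rightarrow> real \<Rightarrow> nat \<Rightarrow> real"
where
  "rec_g M F u Tbar lam n =
     (if Tbar \<le> n then 0
      else rec_g M F u Tbar lam (Suc n) +
           rec_d M F u Tbar lam (Suc n) * (rec_f M F u Tbar lam (Suc n))\<^sup>2)"
  by pat_completeness auto
termination
  by (relation "Wellfounded.measure (\<lambda>(M, F, u, Tbar, lam, n). Tbar - n)") auto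


section \<open>Exceptional sets\<close>

function
  sigma_a :: "'a measure \<Rightarrow> (nat \<Rightarrow> 'a measure) \<Rightarrow> (nat \<Rightarrow> 'a \<Rightarrow> real ^ 'n) \<Rightarrow> nat \<Rightarrow> nat \<Rightarrow> real set"
where
  "sigma_a M F u Tbar n =
     (if Tbar < n then {}
      else sigma_a M F u Tbar (Suc n) \<union>
           {lam. lam \<notin> sigma_a M F u Tbar (Suc n) \<and>
                 is_eigenvalue
                   (Ma M u n -
                    (\<Sum>r\<in>{n+1..Tbar}. (rec_d M F u Tbar lam r * (rec_f M F u Tbar lam r)\<^sup>2) *\<^sub>R Na M F u r n))
                   lam})"
  by pat_completeness auto
termination
  by (relation "Wellfounded.measure (\<lambda>(M, F, u, Tbar, n). Suc Tbar - n)") auto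

function
  sigma_b :: "'a measure \<Rightarrow> (nat \<Rightarrow> 'a measure) \<Rightarrow> (nat \<Rightarrow> 'a \<Rightarrow> real ^ 'n) \<Rightarrow> nat \<Rightarrow> nat \<Rightarrow> real set"
where
  "sigma_b M F u Tbar n =
     (if Tbar < n then {}
      else sigma_b M F u Tbar (Suc n) \<union> sigma_a M F u Tbar n \<union>
           {lam. lam \<notin> sigma_a M F u Tbar (Suc n) \<and>
                 is_eigenvalue
                   (Mb M u n -
                    (\<Sum>r\<in>{n+1..Tbar}. (rec_d M F u Tbar lam r * (rec_f M F u Tbar lam r)\<^sup>2) *\<^sub>R Nb M F u r n))
                   lam})"
  by pat_completeness auto
termination
  by (relation "Wellfounded.measure (\<lambda>(M, F, u, Tbar, n). Suc Tbar - n)") auto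

definition sigma_exc ::
  "op_case \<Rightarrow> 'a measure \<Rightarrow> (nat \<Rightarrow> 'a measure) \<Rightarrow> (nat \<Rightarrow> 'a \<Rightarrow> real ^ 'n) \<Rightarrow> nat \<Rightarrow> nat \<Rightarrow> real set" where
  "sigma_exc c M F u Tbar n =
     (case c of OpA \<Rightarrow> sigma_a M F u Tbar n | OpB \<Rightarrow> sigma_b M F u Tbar n)"


section \<open>The operators\<close>

definition A_op ::
  "'a measure \<Rightarrow> (nat \<Rightarrow> 'a measure) \<Rightarrow> (nat \<Rightarrow> 'a \<Rightarrow> real ^ 'n) \<Rightarrow> nat \<Rightarrow> nat \<Rightarrow>
   ('a \<Rightarrow> real ^ 'n) \<Rightarrow> ('a \<Rightarrow> real ^ 'n)" where
  "A_op M F u k l h = vec_cond_exp M (F k) (\<lambda>x. (u l x \<bullet> h x) *\<^sub>R u k x)"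

definition B_op ::
  "'a measure \<Rightarrow> (nat \<Rightarrow> 'a measure) \<Rightarrow> (nat \<Rightarrow> 'a \<Rightarrow> real ^ 'n) \<Rightarrow> nat \<Rightarrow> nat \<Rightarrow>
   ('a \<Rightarrow> real ^ 'n) \<Rightarrow> ('a \<Rightarrow> real ^ 'n)" where
  "B_op M F u k l h =
     vec_cond_exp M (F k) (\<lambda>x. (u l x \<bullet> h x - (\<integral>y. u l y \<bullet> h y \<partial>M)) *\<^sub>R u k x)"

definition C_op ::
  "op_case \<Rightarrow> 'a measure \<Rightarrow> (nat \<Rightarrow> 'a measure) \<Rightarrow> (nat \<Rightarrow> 'a \<Rightarrow> real ^ 'n) \<Rightarrow> nat \<Rightarrow> nat \<Rightarrow>
   ('a \<Rightarrow> real ^ 'n) \<Rightarrow> ('a \<Rightarrow> real ^ 'n)" where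
  "C_op c M F u k l = (case c of OpA \<Rightarrow> A_op M F u k l | OpB \<Rightarrow> B_op M F u k l)"

text \<open>
  \<open>C_rec c M F u Tbar lam n k l\<close> is $C^n(k,l)$. Since the recursion is stated here for the
  index \<open>n\<close> instead of \<open>n - 1\<close>, the condition \<open>n \<le> k\<close> becomes \<open>n < k\<close>, and so on.
\<close>

function
  C_rec :: "op_case \<Rightarrow> 'a measure \<Rightarrow> (nat \<Rightarrow> 'a measure) \<Rightarrow> (nat \<Rightarrow> 'a \<Rightarrow> real ^ 'n) \<Rightarrow> nat \<Rightarrow> real \<Rightarrow>
            nat \<Rightarrow> nat \<Rightarrow> nat \<Rightarrow> ('a \<Rightarrow> real ^ 'n) \<Rightarrow> ('a \<Rightarrow> real ^ 'n)"
where
  "C_rec c M F u Tbar lam n k l h =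
     (if Tbar \<le> n then
        (if k = l then (\<lambda>x. C_op c M F u k k h x - lam *\<^sub>R h x) else C_op c M F u k l h)
      else if n < k then C_rec c M F u Tbar lam (Suc n) k l h
      else if n < l then (\<lambda>x. 0)
      else if k \<noteq> l then (\<lambda>x. rec_f M F u Tbar lam n *\<^sub>R C_op c M F u k l h x)
      else (case c of
              OpA \<Rightarrow> (\<lambda>x. rec_D M F u Tbar lam n k *v h x)
            | OpB \<Rightarrow> (\<lambda>x. rec_D M F u Tbar lam n k *v h x -
                         ((1 - rec_g M F u Tbar lam n) * (mean_vec M u k \<bullet> (\<integral>y. h y \<partial>M))) *\<^sub>R mean_vec M u k)))"
  by pat_completeness auto
termination
  by (relation "Wellfounded.measure (\<lambda>(c, M, F, u, Tbar, lam, n, k, l, h). Tbar - n)") auto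

function
  xi_rec :: "op_case \<Rightarrow> 'a measure \<Rightarrow> (nat \<Rightarrow> 'a measure) \<Rightarrow> (nat \<Rightarrow> 'a \<Rightarrow> real ^ 'n) \<Rightarrow> nat \<Rightarrow> real \<Rightarrow>
             (nat \<Rightarrow> 'a \<Rightarrow> real ^ 'n) \<Rightarrow> nat \<Rightarrow> nat \<Rightarrow> ('a \<Rightarrow> real ^ 'n)"
where
  "xi_rec c M F u Tbar lam xi n k =
     (if Tbar \<le> n then xi k
      else if n < k then xi_rec c M F u Tbar lam xi (Suc n) k
      else (\<lambda>x. xi_rec c M F u Tbar lam xi (Suc n) k x -
                C_rec c M F u Tbar lam (Suc n) k (Suc n)
                  (op_inverse M (F (Suc n)) (C_rec c M F u Tbar lam (Suc n) (Suc n) (Suc n))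
                     (xi_rec c M F u Tbar lam xi (Suc n) (Suc n))) x))"
  by pat_completeness auto
termination
  by (relation "Wellfounded.measure (\<lambda>(c, M, F, u, Tbar, lam, xi, n, k). Tbar - n)") auto

declare rec_D.simps [simp del] rec_d.simps [simp del] rec_f.simps [simp del] rec_g.simps [simp del]
  sigma_a.simps [simp del] sigma_b.simps [simp del] C_rec.simps [simp del] xi_rec.simps [simp del]


section \<open>The direct sum and the triangular system\<close>

text \<open>Only the components up to \<open>Tbar\<close> of an element of \<open>Hsum M F Tbar\<close> are relevant.\<close>

definition Hsum :: "'a measure \<Rightarrow> (nat \<Rightarrow> 'a measure) \<Rightarrow> nat \<Rightarrow> (nat \<Rightarrow> 'a \<Rightarrow> real ^ 'n) set" where
  "Hsum M F Tbar = Pi {..Tbar} (\<lambda>k. L2 M (F k))"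

definition Hsum_eq ::
  "'a measure \<Rightarrow> nat \<Rightarrow> (nat \<Rightarrow> 'a \<Rightarrow> real ^ 'n) \<Rightarrow> (nat \<Rightarrow> 'a \<Rightarrow> real ^ 'n) \<Rightarrow> bool" where
  "Hsum_eq M Tbar h h' \<longleftrightarrow> (\<forall>k\<le>Tbar. L2_eq M (h k) (h' k))"

definition solves_triangular ::
  "op_case \<Rightarrow> 'a measure \<Rightarrow> (nat \<Rightarrow> 'a measure) \<Rightarrow> (nat \<Rightarrow> 'a \<Rightarrow> real ^ 'n) \<Rightarrow> nat \<Rightarrow> real \<Rightarrow>
   (nat \<Rightarrow> 'a \<Rightarrow> real ^ 'n) \<Rightarrow> (nat \<Rightarrow> 'a \<Rightarrow> real ^ 'n) \<Rightarrow> bool" where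
  "solves_triangular c M F u Tbar lam xi h \<longleftrightarrow>
     (\<forall>k\<le>Tbar. L2_eq M (\<lambda>x. \<Sum>l\<in>{0..k}. C_rec c M F u Tbar lam 0 k l (h l) x)
                        (xi_rec c M F u Tbar lam xi 0 k))"

definition given_successively ::
  "op_case \<Rightarrow> 'a measure \<Rightarrow> (nat \<Rightarrow> 'a measure) \<Rightarrow> (nat \<Rightarrow> 'a \<Rightarrow> real ^ 'n) \<Rightarrow> nat \<Rightarrow> real \<Rightarrow>
   (nat \<Rightarrow> 'a \<Rightarrow> real ^ 'n) \<Rightarrow> (nat \<Rightarrow> 'a \<Rightarrow> real ^ 'n) \<Rightarrow> bool" where
  "given_successively c M F u Tbar lam xi h \<longleftrightarrow>
     (\<forall>k\<le>Tbar. L2_eq M (h k)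
        (op_inverse M (F k) (C_rec c M F u Tbar lam k k k)
           (\<lambda>x. xi_rec c M F u Tbar lam xi 0 k x -
                 (\<Sum>l\<in>{0..<k}. C_rec c M F u Tbar lam 0 k l (h l) x))))"

end

(*
  Unfolding the recursion shows C^0(k,l) = C^k(k,l), so the system is lower triangular with the
  diagonal operators C^k(k,k), and everything rests on inverting these. By (H1), each of them has
  the form h |-> P h + Q E(h) with constant matrices P = D_k(k) and Q (zero in case A). Such an
  operator acts as P on mean zero vectors and as P + Q on constants, and lambda outside the
  exceptional set says exactly that P (and, in case B, P + Q) is invertible. The off-diagonal
  operators preserve square integrability because u(l) . h(l) is square integrable by (H1) and,
  by the conditional Cauchy-Schwarz inequality, |E(u_i(k) Y | F_k)|^2 <= E(u_i(k)^2) E(Y^2 | F_k).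
*)
theory Submission
  imports Defs
begin

section \<open>The matrix recursion and the exceptional sets\<close>

text \<open>Vectors are represented by functions, and \<open>op_inverse\<close> is a mere choice,
  determined only up to null sets. The solution formula is therefore meaningful only if every
  operator involved respects a.e. equality. For the diagonal operators and their inverses this
  follows from additivity and a norm bound; the off-diagonal ones act between different spaces H_l
  and H_k, and their compatibility is derived from that of conditional expectations. The diagonal
  operators arise in two ways. For k < Tbar, C^k(k,k) has the form P h + Q E(h) by definition; at k
  = Tbar it is a conditional expectation, which takes this form a.e. through (H1). The inversion
  lemma is therefore stated for operators that agree a.e. with such a form. The inverses also occur
  inside xi^0, so invertibility has to be known before the right-hand side can be shown to be square
  integrable.\<close>

lemma rec_D_eq_sum:
  assumes "n \<le> Tbar"
  shows "rec_D M F u Tbar lam n k =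
    Ma M u k -
    (\<Sum>r\<in>{n+1..Tbar}. (rec_d M F u Tbar lam r * (rec_f M F u Tbar lam r)\<^sup>2) *\<^sub>R Na M F u r k) -
    mat lam"
  using assms
proof (induction rule: inc_induct)
  case base
  then show ?case by (subst rec_D.simps) simp
next
  case (step n)
  have "{n + 1..Tbar} = insert (Suc n) {Suc n + 1..Tbar}"
    using step(2) by auto
  then show ?case
    using step by (subst rec_D.simps) simp
qed

lemma rec_g_eq_sum:
  assumes "n \<le> Tbar"
  shows "rec_g M F u Tbar lam n =
    (\<Sum>r\<in>{n+1..Tbar}. rec_d M F u Tbar lam r * (rec_f M F u Tbar lam r)\<^sup>2)"
  using assms
proof (induction rule: inc_induct)
  case base
  then show ?case by (subst rec_g.simps) simp
next
  case (step n)
  have "{n + 1..Tbar} = insert (Suc n) {Suc n + 1..Tbar}"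
    using step(2) by auto
  then show ?case
    using step by (subst rec_g.simps) simp
qed

section \<open>Invertibility of shifted matrices and avoidance of the exceptional sets\<close>

lemma mat_mult_vec: "mat (a::real) *v v = a *\<^sub>R v"
  by (simp add: vec_eq_iff matrix_vector_mult_def mat_def if_distrib[of "\<lambda>x. x * _"] cong: if_cong)

lemma invertible_if_not_eigenvalue:
  fixes Q :: "real ^ 'n ^ 'n"
  assumes "\<not> is_eigenvalue Q lam"
  shows "invertible (Q - mat lam)"
proof -
  have "v = 0" if "(Q - mat lam) *v v = 0" for v
    using assms that by (auto simp: is_eigenvalue_def matrix_vector_mult_diff_rdistrib mat_mult_vec)
  then show ?thesis
    using invertible_left_inverse matrix_left_invertible_ker by blast
qed

lemma matrix_inv_mult_vec:
  fixes P :: "real ^ 'n ^ 'n"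
  assumes "invertible P"
  shows "matrix_inv P *v (P *v x) = x" "P *v (matrix_inv P *v x) = x"
proof -
  have "\<exists>B. P ** B = mat 1 \<and> B ** P = mat 1"
    using assms by (simp add: invertible_def)
  then have "P ** matrix_inv P = mat 1 \<and> matrix_inv P ** P = mat 1"
    unfolding matrix_inv_def by (rule someI_ex)
  then show "matrix_inv P *v (P *v x) = x" "P *v (matrix_inv P *v x) = x"
    by (simp_all add: matrix_vector_mul_assoc)
qed

text \<open>The rank-one matrix v w^T. With v = w = E(u(k)) it turns the mean terms of case B into
  matrices.\<close>

definition outer :: "real ^ 'n \<Rightarrow> real ^ 'n \<Rightarrow> real ^ 'n ^ 'n" where
  "outer v w = (\<chi> i j. v $ i * w $ j)"

lemma outer_mult_vec: "outer v w *v x = (w \<bullet> x) *\<^sub>R v"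
  by (simp add: vec_eq_iff outer_def matrix_vector_mult_def inner_vec_def sum_distrib_left
      mult_ac)

text \<open>Lets the single assumption on the set of index 0 control every stage of the
  recursion.\<close>

lemma sigma_a_antimono:
  assumes "m \<le> n"
  shows "sigma_a M F u Tbar n \<subseteq> sigma_a M F u Tbar m"
  using assms
proof (induction rule: inc_induct)
  case (step m)
  have "sigma_a M F u Tbar (Suc m) \<subseteq> sigma_a M F u Tbar m"
  proof (cases "Tbar < m")
    case True
    then have "sigma_a M F u Tbar (Suc m) = {}"
      by (subst sigma_a.simps) simp
    then show ?thesis by simp
  next
    case False
    then show ?thesis by (subst (2) sigma_a.simps) auto
  qed
  with step show ?case by blast
qed simp

lemma sigma_b_antimono:
  assumes "m \<le> n"
  shows "sigma_b M F u Tbar n \<subseteq> sigma_b M F u Tbar m"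
  using assms
proof (induction rule: inc_induct)
  case (step m)
  have "sigma_b M F u Tbar (Suc m) \<subseteq> sigma_b M F u Tbar m"
  proof (cases "Tbar < m")
    case True
    then have "sigma_b M F u Tbar (Suc m) = {}"
      by (subst sigma_b.simps) simp
    then show ?thesis by simp
  next
    case False
    then show ?thesis by (subst (2) sigma_b.simps) auto
  qed
  with step show ?case by blast
qed simp

text \<open>By the closed sum form of the recursion, the matrix tested in \<open>sigma_a\<close> at
  its own parameter is D_n(n) + lam I.\<close>

lemma invertible_rec_D_sigma_a:
  assumes "lam \<notin> sigma_a M F u Tbar n" "n \<le> Tbar"
  shows "invertible (rec_D M F u Tbar lam n n)"
proof -
  have "\<not> is_eigenvalue (Ma M u n -
    (\<Sum>r\<in>{n+1..Tbar}. (rec_d M F u Tbar lam r * (rec_f M F u Tbar lam r)\<^sup>2) *\<^sub>R Na M F u r n)) lam"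
    using assms by (subst (asm) sigma_a.simps) auto
  then show ?thesis
    unfolding rec_D_eq_sum[OF assms(2)] by (rule invertible_if_not_eigenvalue)
qed

text \<open>The factor $1 - g_n$ collects the mean terms by which $M^b$ and $N^b_r$
  differ from $M^a$ and $N^a_r$.\<close>

lemma invertible_rec_D_sigma_b:
  assumes "lam \<notin> sigma_b M F u Tbar n" "n \<le> Tbar"
    and Mb: "Mb M u n = Ma M u n - outer (mean_vec M u n) (mean_vec M u n)"
    and Nb: "\<And>r. Nb M F u r n = Na M F u r n - outer (mean_vec M u n) (mean_vec M u n)"
  shows "invertible (rec_D M F u Tbar lam n n -
    (1 - rec_g M F u Tbar lam n) *\<^sub>R outer (mean_vec M u n) (mean_vec M u n))"
proof -
  let ?c = "\<lambda>r. rec_d M F u Tbar lam r * (rec_f M F u Tbar lam r)\<^sup>2"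
  have "lam \<notin> sigma_a M F u Tbar n"
    using assms by (subst (asm) sigma_b.simps) auto
  \<comment> \<open>The eigenvalue clause of \<open>sigma_b\<close> is guarded by avoidance of
    \<open>sigma_a\<close> at n + 1, which has to be secured first.\<close>
  then have "lam \<notin> sigma_a M F u Tbar (Suc n)"
    using sigma_a_antimono[of n "Suc n" M F u Tbar] by auto
  then have "\<not> is_eigenvalue (Mb M u n - (\<Sum>r\<in>{n+1..Tbar}. ?c r *\<^sub>R Nb M F u r n)) lam"
    using assms(1,2) by (subst (asm) sigma_b.simps) auto
  then have "invertible (Mb M u n - (\<Sum>r\<in>{n+1..Tbar}. ?c r *\<^sub>R Nb M F u r n) - mat lam)"
    by (rule invertible_if_not_eigenvalue)
  also have "Mb M u n - (\<Sum>r\<in>{n+1..Tbar}. ?c r *\<^sub>R Nb M F u r n) - mat lam =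
    rec_D M F u Tbar lam n n -
    (1 - rec_g M F u Tbar lam n) *\<^sub>R outer (mean_vec M u n) (mean_vec M u n)"
    unfolding rec_D_eq_sum[OF assms(2)] rec_g_eq_sum[OF assms(2)] Mb Nb
    by (simp add: algebra_simps sum_subtractf scaleR_sum_left sum.distrib)
  finally show ?thesis .
qed

text \<open>At every stage n < k the recursion merely copies row k from stage n + 1. The induction
  walks down from k by writing the stage as \<open>k - m\<close>.\<close>

lemma C_rec_0_eq:
  assumes "k \<le> Tbar"
  shows "C_rec c M F u Tbar lam 0 k l = C_rec c M F u Tbar lam k k l"
proof -
  have "C_rec c M F u Tbar lam (k - m) k l = C_rec c M F u Tbar lam k k l" if "m \<le> k" for m
    using that
  proof (induction m)
    case (Suc m)
    then have "Suc (k - Suc m) = k - m" by simp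
    moreover have "\<not> Tbar \<le> k - Suc m" using Suc.prems assms by linarith
    ultimately show ?case
      using Suc assms
      by (intro ext) (subst C_rec.simps, simp)
  qed simp
  from this[of k] show ?thesis by simp
qed

text \<open>The scalar is 1, 0 or some f_m and does not depend on the argument, so properties of the
  off-diagonal entries reduce to those of C(k,l).\<close>

lemma C_rec_offdiag:
  assumes "k \<noteq> l"
  obtains a where "C_rec c M F u Tbar lam n k l = (\<lambda>h x. a *\<^sub>R C_op c M F u k l h x)"
proof -
  have "\<exists>a. C_rec c M F u Tbar lam n k l = (\<lambda>h x. a *\<^sub>R C_op c M F u k l h x)"
  proof (induction "Tbar - n" arbitrary: n)
    case 0
    then have "C_rec c M F u Tbar lam n k l = (\<lambda>h x. 1 *\<^sub>R C_op c M F u k l h x)"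
      using assms by (intro ext) (subst C_rec.simps, simp)
    then show ?case by blast
  next
    case (Suc m)
    then have n: "\<not> Tbar \<le> n" by linarith
    consider "n < k" | "k \<le> n" "n < l" | "k \<le> n" "l \<le> n"
      by linarith
    then show ?case
    proof cases
      case 1
      then have "C_rec c M F u Tbar lam n k l = C_rec c M F u Tbar lam (Suc n) k l"
        using n by (intro ext) (subst C_rec.simps, simp)
      then show ?thesis using Suc by simp
    next
      case 2
      then have "C_rec c M F u Tbar lam n k l = (\<lambda>h x. 0 *\<^sub>R C_op c M F u k l h x)"
        using n by (intro ext) (subst C_rec.simps, simp)
      then show ?thesis by blast
    next
      case 3
      then have "C_rec c M F u Tbar lam n k l =
          (\<lambda>h x. rec_f M F u Tbar lam n *\<^sub>R C_op c M F u k l h x)"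
        using n assms by (intro ext) (subst C_rec.simps, simp)
      then show ?thesis by blast
    qed
  qed
  with that show ?thesis by blast
qed

section \<open>Operators of the form $h \mapsto P h + Q\,E(h)$\<close>

lemma borel_measurable_vec_iff:
  "f \<in> borel_measurable N \<longleftrightarrow> (\<forall>i. (\<lambda>x. f x $ i) \<in> borel_measurable N)" for f :: "'a \<Rightarrow> real ^ 'n"
  by (subst borel_measurable_euclidean_space) (auto simp: Basis_vec_def inner_axis)

lemma borel_measurable_vec_nth: "(\<lambda>v :: real ^ 'n. v $ i) \<in> borel_measurable borel"
  by (intro borel_measurable_continuous_onI continuous_intros)

lemma power2_norm_vec: "(norm v)\<^sup>2 = (\<Sum>i\<in>UNIV. (v $ i)\<^sup>2)" for v :: "real ^ 'n"
  unfolding power2_norm_eq_inner by (simp add: inner_vec_def power2_eq_square)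

lemma integral_vec_nth:
  fixes f :: "'a \<Rightarrow> real ^ 'n"
  assumes "integrable N f"
  shows "(\<integral>x. f x \<partial>N) $ i = (\<integral>x. f x $ i \<partial>N)"
  by (rule integral_bounded_linear[symmetric]) (use assms in \<open>auto intro: bounded_linear_vec_nth\<close>)

text \<open>The parallelogram identity with one square dropped; it serves as triangle inequality for
  squared norms.\<close>

lemma power2_norm_add_le:
  fixes a b :: "'b::real_inner"
  shows "(norm (a + b))\<^sup>2 \<le> 2 * (norm a)\<^sup>2 + 2 * (norm b)\<^sup>2"
proof -
  have "(norm (a + b))\<^sup>2 + (norm (a - b))\<^sup>2 = 2 * (norm a)\<^sup>2 + 2 * (norm b)\<^sup>2"
    by (simp add: power2_norm_eq_inner algebra_simps inner_commute)
  then show ?thesis by (smt (verit) zero_le_power2)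
qed

section \<open>Square integrable vectors and bounded operators over one sub-sigma-algebra\<close>

locale prob_subalgebra = prob_space M + finite_measure_subalgebra M G
  for M :: "'a measure" and G :: "'a measure"
begin

lemma L2_meas_sub: "f \<in> L2 M G \<Longrightarrow> f \<in> borel_measurable G"
  by (simp add: L2_def)

lemma L2_meas: "f \<in> L2 M G \<Longrightarrow> f \<in> borel_measurable M"
  using measurable_from_subalg[OF subalg] by (auto simp: L2_def)

lemma L2_sq: "f \<in> L2 M G \<Longrightarrow> integrable M (\<lambda>x. (norm (f x))\<^sup>2)"
  by (simp add: L2_def)

lemma L2_dominated:
  assumes f: "f \<in> borel_measurable G" and g: "integrable M g"
    and le: "AE x in M. (norm (f x))\<^sup>2 \<le> g x"
  shows "f \<in> L2 M G"
proof -
  have [measurable]: "f \<in> borel_measurable M"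
    using f measurable_from_subalg[OF subalg] by blast
  have "integrable M (\<lambda>x. (norm (f x))\<^sup>2)"
    by (rule Bochner_Integration.integrable_bound[OF g]) (use le in auto)
  with f show ?thesis by (simp add: L2_def)
qed

lemma L2_add:
  assumes "f \<in> L2 M G" "g \<in> L2 M G"
  shows "(\<lambda>x. f x + g x) \<in> L2 M G"
proof (rule L2_dominated)
  show "(\<lambda>x. f x + g x) \<in> borel_measurable G"
    using assms[THEN L2_meas_sub] by measurable
  show "integrable M (\<lambda>x. 2 * (norm (f x))\<^sup>2 + 2 * (norm (g x))\<^sup>2)"
    using assms[THEN L2_sq] by auto
qed (simp add: power2_norm_add_le)

lemma L2_bounded_linear:
  assumes T: "bounded_linear T" and f: "f \<in> L2 M G"
  shows "(\<lambda>x. T (f x)) \<in> L2 M G"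
proof -
  obtain K where K: "\<And>v. norm (T v) \<le> norm v * K"
    using bounded_linear.bounded[OF T] by blast
  show ?thesis
  proof (rule L2_dominated)
  have "T \<in> borel_measurable borel"
    by (intro borel_measurable_continuous_onI bounded_linear.continuous_on[OF T] continuous_on_id)
  then show "(\<lambda>x. T (f x)) \<in> borel_measurable G"
    using L2_meas_sub[OF f] by (rule measurable_compose[rotated])
  show "integrable M (\<lambda>x. (norm (f x))\<^sup>2 * K\<^sup>2)"
    using L2_sq[OF f] by simp
  show "AE x in M. (norm (T (f x)))\<^sup>2 \<le> (norm (f x))\<^sup>2 * K\<^sup>2"
    using K by (intro AE_I2) (metis norm_ge_zero power_mono power_mult_distrib)
  qed
qed

lemma L2_scaleR: "f \<in> L2 M G \<Longrightarrow> (\<lambda>x. a *\<^sub>R f x) \<in> L2 M G"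
  by (rule L2_bounded_linear) (rule bounded_linear_scaleR_right)

lemma L2_diff: "f \<in> L2 M G \<Longrightarrow> g \<in> L2 M G \<Longrightarrow> (\<lambda>x. f x - g x) \<in> L2 M G"
  using L2_add[OF _ L2_scaleR[of g "-1"], of f] by simp

lemma L2_const: "(\<lambda>x. v) \<in> L2 M G"
  by (simp add: L2_def)

lemma L2_sum: "(\<And>l. l \<in> I \<Longrightarrow> f l \<in> L2 M G) \<Longrightarrow> (\<lambda>x. \<Sum>l\<in>I. f l x) \<in> L2 M G"
  by (induction I rule: infinite_finite_induct) (auto intro: L2_add L2_const)

lemma L2_integrable:
  assumes "f \<in> L2 M G"
  shows "integrable M f"
proof (rule Bochner_Integration.integrable_bound)
  \<comment> \<open>The dominating function comes from t \<le> 1 + t^2; the constant is integrable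
    because the measure is finite.\<close>
  show "integrable M (\<lambda>x. 1 + (norm (f x))\<^sup>2)"
    using L2_sq[OF assms] by simp
  show "f \<in> borel_measurable M" by (rule L2_meas[OF assms])
  show "AE x in M. norm (f x) \<le> norm (1 + (norm (f x))\<^sup>2)"
  proof (rule AE_I2)
    fix x
    show "norm (f x) \<le> norm (1 + (norm (f x))\<^sup>2)"
      using zero_le_power2[of "norm (f x) - 1"] by (simp add: power2_diff) (smt (verit) norm_ge_zero)
  qed
qed

text \<open>Jensen's inequality for the square, read off from the nonnegative variance of the
  norm.\<close>

lemma norm_expectation_sq_le:
  assumes "f \<in> L2 M G"
  shows "(norm (expectation f))\<^sup>2 \<le> expectation (\<lambda>x. (norm (f x))\<^sup>2)"
proof -
  have "(expectation (\<lambda>x. norm (f x)))\<^sup>2 \<le> expectation (\<lambda>x. (norm (f x))\<^sup>2)"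
    using variance_eq[of "\<lambda>x. norm (f x)"] variance_positive[of "\<lambda>x. norm (f x)"]
      L2_integrable[OF assms] L2_sq[OF assms] by simp
  moreover have "norm (expectation f) \<le> expectation (\<lambda>x. norm (f x))"
    by simp
  ultimately show ?thesis
    by (meson norm_ge_zero order_trans power_mono)
qed

text \<open>The norm bound sends the null function f - g to a null function, and additivity gives S
  f = S (f - g) + S g a.e.\<close>

lemma bounded_op_cong:
  assumes S: "bounded_op M G S" and f: "f \<in> L2 M G" and g: "g \<in> L2 M G"
    and eq: "L2_eq M f g"
  shows "L2_eq M (S f) (S g)"
proof -
  let ?d = "\<lambda>x. f x - g x"
  have d: "?d \<in> L2 M G" using f g by (rule L2_diff)
  have "L2_norm M ?d = 0"
  proof -
    have "expectation (\<lambda>x. (norm (?d x))\<^sup>2) = 0"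
      by (rule integral_eq_zero_AE) (use eq in \<open>auto simp: L2_eq_def\<close>)
    then show ?thesis by (simp add: L2_norm_def)
  qed
  moreover obtain K where "\<And>f. f \<in> L2 M G \<Longrightarrow> L2_norm M (S f) \<le> K * L2_norm M f"
    using S unfolding bounded_op_def by metis
  ultimately have "L2_norm M (S ?d) \<le> 0" using d by force
  then have "expectation (\<lambda>x. (norm (S ?d x))\<^sup>2) \<le> 0"
    by (simp add: L2_norm_def)
  then have "expectation (\<lambda>x. (norm (S ?d x))\<^sup>2) = 0"
    by (simp add: antisym)
  moreover have Sd: "S ?d \<in> L2 M G" using S d by (auto simp: bounded_op_def)
  ultimately have "AE x in M. (norm (S ?d x))\<^sup>2 = 0"
    using integral_nonneg_eq_0_iff_AE[OF L2_sq[OF Sd]] by simp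
  \<comment> \<open>As a function, (f - g) + g is f itself, so nothing has to be replaced a.e.
    inside \<open>S\<close>.\<close>
  moreover have "L2_eq M (S (\<lambda>x. ?d x + g x)) (\<lambda>x. S ?d x + S g x)"
    by (rule S[unfolded bounded_op_def, THEN conjunct2, THEN conjunct1, rule_format, OF d g])
  ultimately show ?thesis by (auto simp: L2_eq_def)
qed

lemma is_bounded_inverse_op_inverse:
  assumes "has_bounded_inverse M G S"
  shows "is_bounded_inverse M G S (op_inverse M G S)"
  using assms unfolding has_bounded_inverse_def op_inverse_def by (rule someI_ex)

text \<open>The operators $h \mapsto P h + Q\,E(h)$ form an algebra, in which $(P, Q)$ is invertible
  as soon as $P$ (on the mean-zero part) and $P + Q$ (on the constants) are.\<close>

definition mean_op :: "real ^ 'n ^ 'n \<Rightarrow> real ^ 'n ^ 'n \<Rightarrow> ('a \<Rightarrow> real ^ 'n) \<Rightarrow> ('a \<Rightarrow> real ^ 'n)" where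
  "mean_op P Q h = (\<lambda>x. P *v h x + Q *v expectation h)"

lemma mean_op_L2: "h \<in> L2 M G \<Longrightarrow> mean_op P Q h \<in> L2 M G"
  unfolding mean_op_def
  by (intro L2_add L2_const L2_bounded_linear[of "(*v) P"] matrix_vector_mul_bounded_linear)

lemma expectation_mean_op:
  assumes "h \<in> L2 M G"
  shows "expectation (mean_op P Q h) = (P + Q) *v expectation h"
proof -
  have h: "integrable M h" by (rule L2_integrable[OF assms])
  have "integrable M (\<lambda>x. P *v h x)"
    using integrable_bounded_linear[OF matrix_vector_mul_bounded_linear h] .
  then show ?thesis
    using integral_bounded_linear[OF matrix_vector_mul_bounded_linear h, of P]
    by (simp add: mean_op_def prob_space matrix_vector_mult_add_rdistrib)
qed

lemma mean_op_norm_bound: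
  obtains K where "\<And>h. h \<in> L2 M G \<Longrightarrow> L2_norm M (mean_op P Q h) \<le> K * L2_norm M h"
proof -
  obtain p where p: "\<And>v. norm (P *v v) \<le> norm v * p"
    using bounded_linear.bounded[OF matrix_vector_mul_bounded_linear[of P]] by blast
  obtain q where q: "\<And>v. norm (Q *v v) \<le> norm v * q"
    using bounded_linear.bounded[OF matrix_vector_mul_bounded_linear[of Q]] by blast
  have p2: "(norm (P *v v))\<^sup>2 \<le> (norm v)\<^sup>2 * p\<^sup>2" for v
    using p by (metis norm_ge_zero power_mono power_mult_distrib)
  have q2: "(norm (Q *v v))\<^sup>2 \<le> (norm v)\<^sup>2 * q\<^sup>2" for v
    using q by (metis norm_ge_zero power_mono power_mult_distrib)
  \<comment> \<open>The parallelogram bound gives 2 p^2 |h|^2 + 2 q^2 |E(h)|^2, and Jensen bounds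
    |E(h)|^2 by E(|h|^2); hence the constant.\<close>
  have "L2_norm M (mean_op P Q h) \<le> sqrt (2 * (p\<^sup>2 + q\<^sup>2)) * L2_norm M h" if h: "h \<in> L2 M G" for h
  proof -
    let ?e = "expectation h"
    have "expectation (\<lambda>x. (norm (mean_op P Q h x))\<^sup>2) \<le>
        expectation (\<lambda>x. 2 * p\<^sup>2 * (norm (h x))\<^sup>2 + 2 * q\<^sup>2 * (norm ?e)\<^sup>2)"
    proof (rule integral_mono)
      fix x
      show "(norm (mean_op P Q h x))\<^sup>2 \<le> 2 * p\<^sup>2 * (norm (h x))\<^sup>2 + 2 * q\<^sup>2 * (norm ?e)\<^sup>2"
        unfolding mean_op_def
        using power2_norm_add_le[of "P *v h x" "Q *v ?e"] p2[of "h x"] q2[of ?e]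
        by (simp add: mult_ac)
    qed (use L2_sq[OF mean_op_L2[OF h]] L2_sq[OF h] in auto)
    also have "\<dots> = 2 * p\<^sup>2 * expectation (\<lambda>x. (norm (h x))\<^sup>2) + 2 * q\<^sup>2 * (norm ?e)\<^sup>2"
      using L2_sq[OF h] by (simp add: prob_space)
    also have "\<dots> \<le> 2 * (p\<^sup>2 + q\<^sup>2) * expectation (\<lambda>x. (norm (h x))\<^sup>2)"
      using mult_left_mono[OF norm_expectation_sq_le[OF h], of "2 * q\<^sup>2"]
      by (simp add: algebra_simps)
    finally show ?thesis
      unfolding L2_norm_def real_sqrt_mult[symmetric] by (rule real_sqrt_le_mono)
  qed
  then show ?thesis by (rule that)
qed

text \<open>Covers operators that are only a.e. of the mean form, such as a conditional expectation.
  Membership in L2 is a separate premise because a.e. equality does not preserve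
  \<open>G\<close>-measurability.\<close>

lemma bounded_op_AE_mean_op:
  assumes S: "\<And>h. h \<in> L2 M G \<Longrightarrow> S h \<in> L2 M G"
    and eq: "\<And>h. h \<in> L2 M G \<Longrightarrow> L2_eq M (S h) (mean_op P Q h)"
  shows "bounded_op M G S"
proof -
  have norm: "L2_norm M (S h) = L2_norm M (mean_op P Q h)" if h: "h \<in> L2 M G" for h
  proof -
    have "expectation (\<lambda>x. (norm (S h x))\<^sup>2) = expectation (\<lambda>x. (norm (mean_op P Q h x))\<^sup>2)"
      using eq[OF h] L2_sq[OF S[OF h]] L2_sq[OF mean_op_L2[OF h]]
      by (intro integral_cong_AE) (auto simp: L2_eq_def)
    then show ?thesis by (simp add: L2_norm_def)
  qed
  have add: "L2_eq M (S (\<lambda>x. f x + g x)) (\<lambda>x. S f x + S g x)"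
    if f: "f \<in> L2 M G" and g: "g \<in> L2 M G" for f g
    using eq[OF L2_add[OF f g]] eq[OF f] eq[OF g] unfolding L2_eq_def
    by eventually_elim
      (simp add: mean_op_def matrix_vector_right_distrib L2_integrable[OF f] L2_integrable[OF g])
  have scale: "L2_eq M (S (\<lambda>x. a *\<^sub>R f x)) (\<lambda>x. a *\<^sub>R S f x)" if f: "f \<in> L2 M G" for a f
    using eq[OF L2_scaleR[OF f, of a]] eq[OF f] unfolding L2_eq_def
    by eventually_elim (simp add: mean_op_def scaleR_add_right matrix_vector_mult_scaleR)
  obtain K where "\<And>h. h \<in> L2 M G \<Longrightarrow> L2_norm M (mean_op P Q h) \<le> K * L2_norm M h"
    using mean_op_norm_bound by blast
  then have "\<exists>K. \<forall>h\<in>L2 M G. L2_norm M (S h) \<le> K * L2_norm M h"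
    by (intro exI[of _ K] ballI) (simp add: norm)
  then show ?thesis
    unfolding bounded_op_def by (intro conjI ballI allI S add scale)
qed

lemma has_bounded_inverse_AE_mean_op:
  assumes S: "\<And>h. h \<in> L2 M G \<Longrightarrow> S h \<in> L2 M G"
    and eq: "\<And>h. h \<in> L2 M G \<Longrightarrow> L2_eq M (S h) (mean_op P Q h)"
    and P: "invertible P" and PQ: "invertible (P + Q)"
  shows "has_bounded_inverse M G S"
proof -
  \<comment> \<open>The inverse must act as P^-1 on mean-zero vectors and as (P + Q)^-1 on
    constants; since the action on constants is the sum of both coefficients, this forces
    \<open>?Q\<close>.\<close>
  let ?P = "matrix_inv P" and ?Q = "matrix_inv (P + Q) - matrix_inv P"
  have bR: "bounded_op M G (mean_op ?P ?Q)"
    by (rule bounded_op_AE_mean_op) (auto simp: L2_eq_def mean_op_L2)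
  have "L2_eq M (mean_op ?P ?Q (S h)) h" if h: "h \<in> L2 M G" for h
  proof -
    \<comment> \<open>Here \<open>S h\<close> is replaced inside the inverse, where only a.e.
      equality is known, so boundedness of the inverse is used.\<close>
    have "L2_eq M (mean_op ?P ?Q (S h)) (mean_op ?P ?Q (mean_op P Q h))"
      by (rule bounded_op_cong[OF bR S[OF h] mean_op_L2[OF h] eq[OF h]])
    moreover have "mean_op ?P ?Q (mean_op P Q h) = h"
      unfolding mean_op_def[of ?P ?Q] expectation_mean_op[OF h]
      unfolding mean_op_def
      by (rule ext)
        (simp add: matrix_vector_right_distrib matrix_vector_mult_diff_rdistrib matrix_inv_mult_vec P PQ,
         simp add: matrix_vector_mult_add_rdistrib matrix_vector_right_distrib matrix_inv_mult_vec P)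
    ultimately show ?thesis by simp
  qed
  moreover have "L2_eq M (S (mean_op ?P ?Q h)) h" if h: "h \<in> L2 M G" for h
  proof -
    have "L2_eq M (S (mean_op ?P ?Q h)) (mean_op P Q (mean_op ?P ?Q h))"
      by (rule eq[OF mean_op_L2[OF h]])
    moreover have "mean_op P Q (mean_op ?P ?Q h) = h"
    proof
      fix x
      let ?e = "expectation h"
      have "mean_op P Q (mean_op ?P ?Q h) x = h x + P *v (?Q *v ?e) + Q *v (matrix_inv (P + Q) *v ?e)"
        unfolding mean_op_def[of P Q] expectation_mean_op[OF h]
        unfolding mean_op_def
        by (simp add: matrix_vector_right_distrib matrix_inv_mult_vec P)
      \<comment> \<open>The terms P (P + Q)^-1 E(h) and Q (P + Q)^-1 E(h) combine, so that what
        remains besides h is E(h) - E(h).\<close>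
      also have "\<dots> = h x + (P + Q) *v (matrix_inv (P + Q) *v ?e) - P *v (matrix_inv P *v ?e)"
        by (simp add: matrix_vector_mult_add_rdistrib matrix_vector_mult_diff_rdistrib
            matrix_vector_mult_diff_distrib)
      also have "\<dots> = h x"
        by (simp only: matrix_inv_mult_vec P PQ) simp
      finally show "mean_op P Q (mean_op ?P ?Q h) x = h x" .
    qed
    ultimately show ?thesis by simp
  qed
  ultimately have "is_bounded_inverse M G S (mean_op ?P ?Q)"
    using bR bounded_op_AE_mean_op[OF S eq] by (simp add: is_bounded_inverse_def)
  then show ?thesis by (auto simp: has_bounded_inverse_def)
qed

end

section \<open>Conditional expectations of products\<close>

context prob_subalgebra
begin

text \<open>Conditional Cauchy--Schwarz against a factor with constant conditional second moment; the
  discriminant argument needs one null set for all $t$, hence the detour through rational $t$.\<close>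

lemma real_cond_exp_mult_square_integrable:
  assumes X[measurable]: "X \<in> borel_measurable M" and X2: "integrable M (\<lambda>x. (X x)\<^sup>2)"
    and Y[measurable]: "Y \<in> borel_measurable M" and Y2: "integrable M (\<lambda>x. (Y x)\<^sup>2)"
    and c: "AE x in M. real_cond_exp M G (\<lambda>x. (X x)\<^sup>2) x = c"
  shows "integrable M (\<lambda>x. X x * Y x)"
    and "integrable M (\<lambda>x. (real_cond_exp M G (\<lambda>x. X x * Y x) x)\<^sup>2)"
proof -
  show XY: "integrable M (\<lambda>x. X x * Y x)"
  proof (rule Bochner_Integration.integrable_bound)
    show "integrable M (\<lambda>x. (X x)\<^sup>2 + (Y x)\<^sup>2)" using X2 Y2 by simp
    show "AE x in M. norm (X x * Y x) \<le> norm ((X x)\<^sup>2 + (Y x)\<^sup>2)"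
    proof (rule AE_I2)
      fix x
      have "2 * \<bar>X x * Y x\<bar> \<le> (X x)\<^sup>2 + (Y x)\<^sup>2"
        using sum_squares_bound[of "\<bar>X x\<bar>" "\<bar>Y x\<bar>"] by (simp add: abs_mult)
      then show "norm (X x * Y x) \<le> norm ((X x)\<^sup>2 + (Y x)\<^sup>2)" by simp
    qed
  qed simp
  define Z where "Z = real_cond_exp M G (\<lambda>x. X x * Y x)"
  define W where "W = real_cond_exp M G (\<lambda>x. (Y x)\<^sup>2)"
  \<comment> \<open>The conditional expectation of (t X + Y)^2, expanded; Z is the mixed term and W
    that of Y^2.\<close>
  have quad: "AE x in M. 0 \<le> t\<^sup>2 * c + 2 * t * Z x + W x" for t
  proof -
    have i1: "integrable M (\<lambda>x. t\<^sup>2 * (X x)\<^sup>2)" and i2: "integrable M (\<lambda>x. 2 * t * (X x * Y x))"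
      using X2 XY by simp_all
    have "AE x in M. real_cond_exp M G (\<lambda>x. t\<^sup>2 * (X x)\<^sup>2 + 2 * t * (X x * Y x) + (Y x)\<^sup>2) x =
        real_cond_exp M G (\<lambda>x. t\<^sup>2 * (X x)\<^sup>2 + 2 * t * (X x * Y x)) x + W x"
      unfolding W_def using i1 i2 Y2 by (intro real_cond_exp_add) simp_all
    moreover have "AE x in M. real_cond_exp M G (\<lambda>x. t\<^sup>2 * (X x)\<^sup>2 + 2 * t * (X x * Y x)) x =
        real_cond_exp M G (\<lambda>x. t\<^sup>2 * (X x)\<^sup>2) x + real_cond_exp M G (\<lambda>x. 2 * t * (X x * Y x)) x"
      using i1 i2 by (rule real_cond_exp_add)
    moreover have "AE x in M. real_cond_exp M G (\<lambda>x. t\<^sup>2 * (X x)\<^sup>2) x =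
        t\<^sup>2 * real_cond_exp M G (\<lambda>x. (X x)\<^sup>2) x"
      by (rule real_cond_exp_cmult[OF X2])
    moreover have "AE x in M. real_cond_exp M G (\<lambda>x. 2 * t * (X x * Y x)) x = 2 * t * Z x"
      unfolding Z_def by (rule real_cond_exp_cmult[OF XY])
    moreover have "AE x in M. 0 \<le>
        real_cond_exp M G (\<lambda>x. t\<^sup>2 * (X x)\<^sup>2 + 2 * t * (X x * Y x) + (Y x)\<^sup>2) x"
    proof (rule real_cond_exp_pos)
      have "t\<^sup>2 * (X x)\<^sup>2 + 2 * t * (X x * Y x) + (Y x)\<^sup>2 = (t * X x + Y x)\<^sup>2" for x
        by (simp add: power2_eq_square algebra_simps)
      then show "AE x in M. 0 \<le> t\<^sup>2 * (X x)\<^sup>2 + 2 * t * (X x * Y x) + (Y x)\<^sup>2"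
        by simp
    qed simp
    ultimately show ?thesis using c by eventually_elim simp
  qed
  have bound: "AE x in M. (Z x)\<^sup>2 \<le> (\<bar>c\<bar> + 1) * W x"
  proof -
    have "AE x in M. \<forall>t\<in>\<rat>. 0 \<le> t\<^sup>2 * c + 2 * t * Z x + W x"
      using quad by (subst AE_ball_countable) (auto simp: countable_rat)
    then show ?thesis
    proof eventually_elim
      case (elim x)
      let ?q = "\<lambda>t. t\<^sup>2 * c + 2 * t * Z x + W x"
      \<comment> \<open>The quadratic is continuous in t, so its nonnegativity passes from the
        rationals to their closure.\<close>
      have "closure \<rat> \<subseteq> {t. 0 \<le> ?q t}"
        using elim by (intro closure_minimal closed_Collect_le continuous_intros) auto
      then have q: "0 \<le> ?q t" for t by (auto simp: Rats_closure_real)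
      \<comment> \<open>Adding 1 makes A positive even when c = 0, and A \<ge> c keeps the quadratic
        nonnegative; it is then minimised at t = -Z / A.\<close>
      define A where "A = \<bar>c\<bar> + 1"
      have A: "c \<le> A" "0 < A" by (auto simp: A_def)
      let ?t = "- Z x / A"
      have "0 \<le> ?t\<^sup>2 * A + 2 * ?t * Z x + W x"
        using q[of ?t] mult_left_mono[OF A(1), of "?t\<^sup>2"] by simp
      also have "\<dots> = W x - (Z x)\<^sup>2 / A"
        using A by (simp add: power2_eq_square field_simps)
      finally have "(Z x)\<^sup>2 \<le> A * W x" using A by (simp add: field_simps)
      then show ?case by (simp only: A_def)
    qed
  qed
  have "integrable M (\<lambda>x. (\<bar>c\<bar> + 1) * W x)"
    unfolding W_def using real_cond_exp_int(1)[OF Y2] by simp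
  then have "integrable M (\<lambda>x. (Z x)\<^sup>2)"
  proof (rule Bochner_Integration.integrable_bound)
    show "AE x in M. norm ((Z x)\<^sup>2) \<le> norm ((\<bar>c\<bar> + 1) * W x)"
      using bound
    proof eventually_elim
      case (elim x)
      with order_trans[OF zero_le_power2 elim] show ?case
        by (simp only: real_norm_def abs_of_nonneg zero_le_power2)
    qed
  qed (simp add: Z_def)
  then show "integrable M (\<lambda>x. (real_cond_exp M G (\<lambda>x. X x * Y x) x)\<^sup>2)"
    by (simp add: Z_def)
qed

end

section \<open>Consequences of independence from the sub-sigma-algebra\<close>

locale prob_subalgebra_indep = prob_subalgebra M G for M :: "'a measure" and G :: "'a measure" +
  fixes U :: "'a \<Rightarrow> real ^ 'n"
  assumes U_meas[measurable]: "U \<in> borel_measurable M"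
    and U_sq: "integrable M (\<lambda>x. (norm (U x))\<^sup>2)"
    and indep: "indep_set (sets G) (sets (vimage_algebra (space M) U borel))"
begin

text \<open>Events of X lie in G and events of \<phi>(U) in the sigma-algebra generated by U. The
  free \<phi> serves coordinates, products of coordinates and the squared norm.\<close>

lemma indep_var_fun:
  assumes X: "X \<in> borel_measurable G" and \<phi>: "\<phi> \<in> borel_measurable borel"
  shows "indep_var borel X borel (\<lambda>x. \<phi> (U x))"
  unfolding indep_var_eq
proof (intro conjI)
  have space: "space G = space M" using subalg by (simp add: subalgebra_def)
  show "random_variable borel X"
    using X by (rule measurable_from_subalg[OF subalg])
  show "random_variable borel (\<lambda>x. \<phi> (U x))"
    using \<phi> by measurable
  have "sigma_sets (space M) {X -` A \<inter> space M |A. A \<in> sets borel} \<subseteq> sets G"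
    using sets.sigma_sets_subset[of "{X -` A \<inter> space M |A. A \<in> sets borel}" G]
      measurable_sets[OF X] space by auto
  moreover have "(\<lambda>x. \<phi> (U x)) -` A \<inter> space M \<in> sets (vimage_algebra (space M) U borel)"
    if "A \<in> sets borel" for A
  proof -
    have "(\<lambda>x. \<phi> (U x)) -` A \<inter> space M = U -` (\<phi> -` A) \<inter> space M" by auto
    then show ?thesis
      using in_vimage_algebra[of "\<phi> -` A" borel U "space M"] measurable_sets[OF \<phi> that] by simp
  qed
  then have "sigma_sets (space M) {(\<lambda>x. \<phi> (U x)) -` A \<inter> space M |A. A \<in> sets borel} \<subseteq>
      sets (vimage_algebra (space M) U borel)"
    using sets.sigma_sets_subset[of "{(\<lambda>x. \<phi> (U x)) -` A \<inter> space M |A. A \<in> sets borel}"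
        "vimage_algebra (space M) U borel"] by auto
  ultimately show "indep_set (sigma_sets (space M) {X -` A \<inter> space M |A. A \<in> sets borel})
      (sigma_sets (space M) {(\<lambda>x. \<phi> (U x)) -` A \<inter> space M |A. A \<in> sets borel})"
    using indep unfolding indep_sets2_eq by blast
qed

text \<open>For A in G the integral of \<phi>(U) over A factors by independence, so the constant has
  the defining property of the conditional expectation.\<close>

lemma real_cond_exp_fun:
  assumes \<phi>: "\<phi> \<in> borel_measurable borel" and int: "integrable M (\<lambda>x. \<phi> (U x))"
  shows "AE x in M. real_cond_exp M G (\<lambda>x. \<phi> (U x)) x = expectation (\<lambda>x. \<phi> (U x))"
proof (rule real_cond_exp_charact)
  fix A assume A: "A \<in> sets G"
  then have AM: "A \<in> sets M" using subalg by (auto simp: subalgebra_def)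
  have "expectation (\<lambda>x. indicator A x * \<phi> (U x)) =
      expectation (indicator A) * expectation (\<lambda>x. \<phi> (U x))"
    using A AM int by (intro indep_var_lebesgue_integral indep_var_fun \<phi>) (auto simp: emeasure_eq_measure)
  then show "(\<integral>x\<in>A. \<phi> (U x) \<partial>M) = (\<integral>x\<in>A. expectation (\<lambda>x. \<phi> (U x)) \<partial>M)"
    using AM by (simp add: set_lebesgue_integral_def)
qed (use int in auto)

lemma U_nth_integrable: "integrable M (\<lambda>x. U x $ i)" "integrable M (\<lambda>x. (U x $ i)\<^sup>2)"
  and U_nth_mult_integrable: "integrable M (\<lambda>x. U x $ i * U x $ j)"
  and U_integrable: "integrable M U"
proof -
  have [measurable]: "(\<lambda>x. U x $ i) \<in> borel_measurable M" for i
    using U_meas borel_measurable_vec_iff by blast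
  have n: "\<bar>U x $ i\<bar> \<le> norm (U x)" for x i by (rule component_le_norm_cart)
  show "integrable M (\<lambda>x. U x $ i * U x $ j)" for i j
  proof (rule Bochner_Integration.integrable_bound[OF U_sq])
    show "AE x in M. norm (U x $ i * U x $ j) \<le> norm ((norm (U x))\<^sup>2)"
      using n by (intro AE_I2) (simp add: abs_mult power2_eq_square mult_mono)
  qed simp
  from this[of i i] show "integrable M (\<lambda>x. (U x $ i)\<^sup>2)" by (simp add: power2_eq_square)
  show int: "integrable M U"
  proof (rule Bochner_Integration.integrable_bound)
    show "integrable M (\<lambda>x. 1 + (norm (U x))\<^sup>2)" using U_sq by simp
    show "AE x in M. norm (U x) \<le> norm (1 + (norm (U x))\<^sup>2)"
    proof (rule AE_I2)
      fix x
      show "norm (U x) \<le> norm (1 + (norm (U x))\<^sup>2)"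
        using zero_le_power2[of "norm (U x) - 1"]
        by (simp add: power2_diff) (smt (verit) norm_ge_zero)
    qed
  qed simp
  show "integrable M (\<lambda>x. U x $ i)"
    using integrable_bounded_linear[OF bounded_linear_vec_nth int] .
qed

text \<open>A product of two L2 functions is in general only integrable; here independence makes
  |h|^2 |U|^2 integrable, and Cauchy-Schwarz dominates the squared inner product by it.\<close>

lemma inner_L2:
  assumes h: "h \<in> L2 M G"
  shows "(\<lambda>x. U x \<bullet> h x) \<in> borel_measurable M"
    and "integrable M (\<lambda>x. (U x \<bullet> h x)\<^sup>2)"
    and "expectation (\<lambda>x. U x \<bullet> h x) = expectation U \<bullet> expectation h"
proof -
  have [measurable]: "h \<in> borel_measurable M" by (rule L2_meas[OF h])
  have hG: "(\<lambda>x. h x $ i) \<in> borel_measurable G" for i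
    using L2_meas_sub[OF h] by (simp add: borel_measurable_vec_iff)
  have hi: "integrable M (\<lambda>x. h x $ i)" for i
    using integrable_bounded_linear[OF bounded_linear_vec_nth L2_integrable[OF h]] .
  show "(\<lambda>x. U x \<bullet> h x) \<in> borel_measurable M" by measurable
  have "integrable M (\<lambda>x. (norm (h x))\<^sup>2 * (norm (U x))\<^sup>2)"
  proof (intro indep_var_integrable indep_var_fun[where \<phi>="\<lambda>v. (norm v)\<^sup>2"] L2_sq[OF h] U_sq)
    show "(\<lambda>x. (norm (h x))\<^sup>2) \<in> borel_measurable G"
      using L2_meas_sub[OF h] by measurable
  qed measurable
  then show "integrable M (\<lambda>x. (U x \<bullet> h x)\<^sup>2)"
  proof (rule Bochner_Integration.integrable_bound)
    show "AE x in M. norm ((U x \<bullet> h x)\<^sup>2) \<le> norm ((norm (h x))\<^sup>2 * (norm (U x))\<^sup>2)"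
    proof (rule AE_I2)
      fix x
      show "norm ((U x \<bullet> h x)\<^sup>2) \<le> norm ((norm (h x))\<^sup>2 * (norm (U x))\<^sup>2)"
        using power_mono[OF Cauchy_Schwarz_ineq2[of "U x" "h x"], of 2]
        by (simp add: power_mult_distrib mult.commute)
    qed
  qed measurable
  have iv: "indep_var borel (\<lambda>x. h x $ i) borel (\<lambda>x. U x $ i)" for i
    by (rule indep_var_fun[OF hG borel_measurable_vec_nth])
  have "expectation (\<lambda>x. U x \<bullet> h x) = expectation (\<lambda>x. \<Sum>i\<in>UNIV. h x $ i * U x $ i)"
    by (simp add: inner_vec_def mult.commute)
  also have "\<dots> = (\<Sum>i\<in>UNIV. expectation (\<lambda>x. h x $ i * U x $ i))"
    using indep_var_integrable[OF iv hi U_nth_integrable(1)] by (intro Bochner_Integration.integral_sum) 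
  also have "\<dots> = (\<Sum>i\<in>UNIV. expectation (\<lambda>x. h x $ i) * expectation (\<lambda>x. U x $ i))"
    using indep_var_lebesgue_integral[OF iv hi U_nth_integrable(1)] by simp
  also have "\<dots> = expectation U \<bullet> expectation h"
    by (simp add: inner_vec_def integral_vec_nth[OF U_integrable] integral_vec_nth[OF L2_integrable[OF h]]
        mult.commute)
  finally show "expectation (\<lambda>x. U x \<bullet> h x) = expectation U \<bullet> expectation h" .
qed

text \<open>The weight \<open>w\<close> may depend on \<open>U\<close>, so independence does not
  factor the product. What helps is that each coordinate of \<open>U\<close> has a constant
  conditional second moment.\<close>

lemma vec_cond_exp_scaleR_L2:
  assumes [measurable]: "w \<in> borel_measurable M" and w: "integrable M (\<lambda>x. (w x)\<^sup>2)"
  shows "vec_cond_exp M G (\<lambda>x. w x *\<^sub>R U x) \<in> L2 M G"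
proof -
  have sq: "(\<lambda>v :: real ^ 'n. (v $ i)\<^sup>2) \<in> borel_measurable borel" for i
    by (intro borel_measurable_continuous_onI continuous_intros)
  have [measurable]: "(\<lambda>x. U x $ i) \<in> borel_measurable M" for i
    using U_meas borel_measurable_vec_iff by blast
  have int: "integrable M (\<lambda>x. (vec_cond_exp M G (\<lambda>x. w x *\<^sub>R U x) x $ i)\<^sup>2)" for i
    using real_cond_exp_mult_square_integrable(2)[of "\<lambda>x. U x $ i" w, OF _ U_nth_integrable(2) assms(1) w
        real_cond_exp_fun[OF sq U_nth_integrable(2)]]
    by (simp add: vec_cond_exp_def mult.commute)
  have "vec_cond_exp M G (\<lambda>x. w x *\<^sub>R U x) \<in> borel_measurable G"
    by (subst borel_measurable_vec_iff) (simp add: vec_cond_exp_def)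
  then show ?thesis
    by (rule L2_dominated[where g="\<lambda>x. \<Sum>i\<in>UNIV. (vec_cond_exp M G (\<lambda>x. w x *\<^sub>R U x) x $ i)\<^sup>2"])
      (auto simp: int power2_norm_vec)
qed

text \<open>Coordinate i of (U . h) U is the sum of h_j U_i U_j: the G-measurable h_j is pulled out
  and U_i U_j is averaged. The shift \<open>a\<close> is 0 in case A and E(U . h) in case B.\<close>

lemma vec_cond_exp_diag:
  assumes h: "h \<in> L2 M G"
  shows "AE x in M. vec_cond_exp M G (\<lambda>x. (U x \<bullet> h x - a) *\<^sub>R U x) x =
    (\<chi> i j. expectation (\<lambda>x. U x $ i * U x $ j)) *v h x - a *\<^sub>R expectation U"
proof -
  have mult: "(\<lambda>v :: real ^ 'n. v $ i * v $ j) \<in> borel_measurable borel" for i j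
    by (intro borel_measurable_continuous_onI continuous_intros)
  have hG: "(\<lambda>x. h x $ i) \<in> borel_measurable G" for i
    using L2_meas_sub[OF h] by (simp add: borel_measurable_vec_iff)
  have hi: "integrable M (\<lambda>x. h x $ i)" for i
    using integrable_bounded_linear[OF bounded_linear_vec_nth L2_integrable[OF h]] .
  have int: "integrable M (\<lambda>x. h x $ j * (U x $ i * U x $ j))" for i j
    by (rule indep_var_integrable[OF indep_var_fun[OF hG mult] hi U_nth_mult_integrable])
  have comp: "AE x in M. vec_cond_exp M G (\<lambda>x. (U x \<bullet> h x - a) *\<^sub>R U x) x $ i =
    ((\<chi> i j. expectation (\<lambda>x. U x $ i * U x $ j)) *v h x - a *\<^sub>R expectation U) $ i" for i
  proof -
    have expand: "(\<lambda>x. ((U x \<bullet> h x - a) *\<^sub>R U x) $ i) =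
        (\<lambda>x. (\<Sum>j\<in>UNIV. h x $ j * (U x $ i * U x $ j)) - a * U x $ i)"
      by (simp add: fun_eq_iff inner_vec_def algebra_simps sum_distrib_left)
    have nth: "vec_cond_exp M G (\<lambda>x. (U x \<bullet> h x - a) *\<^sub>R U x) x $ i =
        real_cond_exp M G (\<lambda>x. (\<Sum>j\<in>UNIV. h x $ j * (U x $ i * U x $ j)) - a * U x $ i) x" for x
      by (simp only: vec_cond_exp_def vec_lambda_beta expand)
    have "AE x in M. real_cond_exp M G
          (\<lambda>x. (\<Sum>j\<in>UNIV. h x $ j * (U x $ i * U x $ j)) - a * U x $ i) x =
        real_cond_exp M G (\<lambda>x. \<Sum>j\<in>UNIV. h x $ j * (U x $ i * U x $ j)) x -
        real_cond_exp M G (\<lambda>x. a * U x $ i) x"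
      using int U_nth_integrable(1) by (intro real_cond_exp_diff) auto
    moreover have "AE x in M. real_cond_exp M G (\<lambda>x. \<Sum>j\<in>UNIV. h x $ j * (U x $ i * U x $ j)) x =
        (\<Sum>j\<in>UNIV. real_cond_exp M G (\<lambda>x. h x $ j * (U x $ i * U x $ j)) x)"
      using int by (rule real_cond_exp_sum)
    moreover have "AE x in M. \<forall>j\<in>UNIV. real_cond_exp M G (\<lambda>x. h x $ j * (U x $ i * U x $ j)) x =
        h x $ j * expectation (\<lambda>x. U x $ i * U x $ j)"
    proof (rule AE_finite_allI)
      fix j
      have "AE x in M. real_cond_exp M G (\<lambda>x. h x $ j * (U x $ i * U x $ j)) x =
          h x $ j * real_cond_exp M G (\<lambda>x. U x $ i * U x $ j) x"
        using hG U_nth_mult_integrable int by (intro real_cond_exp_mult) auto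
      moreover have "AE x in M. real_cond_exp M G (\<lambda>x. U x $ i * U x $ j) x =
          expectation (\<lambda>x. U x $ i * U x $ j)"
        by (rule real_cond_exp_fun[OF mult U_nth_mult_integrable])
      ultimately show "AE x in M. real_cond_exp M G (\<lambda>x. h x $ j * (U x $ i * U x $ j)) x =
          h x $ j * expectation (\<lambda>x. U x $ i * U x $ j)"
        by eventually_elim simp
    qed simp
    moreover have "AE x in M. real_cond_exp M G (\<lambda>x. a * U x $ i) x =
        a * real_cond_exp M G (\<lambda>x. U x $ i) x"
      by (rule real_cond_exp_cmult[OF U_nth_integrable(1)])
    moreover have "AE x in M. real_cond_exp M G (\<lambda>x. U x $ i) x = expectation (\<lambda>x. U x $ i)"
      by (rule real_cond_exp_fun[OF borel_measurable_vec_nth U_nth_integrable(1)])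
    ultimately show ?thesis
      unfolding nth
      by eventually_elim (simp add: matrix_vector_mult_def integral_vec_nth[OF U_integrable] mult.commute)
  qed
  have "AE x in M. \<forall>i\<in>UNIV. vec_cond_exp M G (\<lambda>x. (U x \<bullet> h x - a) *\<^sub>R U x) x $ i =
    ((\<chi> i j. expectation (\<lambda>x. U x $ i * U x $ j)) *v h x - a *\<^sub>R expectation U) $ i"
    by (rule AE_finite_allI) (use comp in auto)
  then show ?thesis by (simp add: vec_eq_iff)
qed

end

section \<open>The triangular system\<close>

lemma L2_eq_sym: "L2_eq M f g \<Longrightarrow> L2_eq M g f"
  by (simp add: L2_eq_def eq_commute)

lemma L2_eq_trans:
  assumes "L2_eq M f g" "L2_eq M g h"
  shows "L2_eq M f h"
  using assms unfolding L2_eq_def by eventually_elim simp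

lemma (in prob_subalgebra) bounded_inverse_solve:
  assumes inv: "is_bounded_inverse M G S R"
    and h: "h \<in> L2 M G" and y: "y \<in> L2 M G"
  shows "L2_eq M (S h) y \<longleftrightarrow> L2_eq M h (R y)"
proof
  have S: "bounded_op M G S" and R: "bounded_op M G R"
    using inv by (auto simp: is_bounded_inverse_def)
  have Sh: "S h \<in> L2 M G" and Ry: "R y \<in> L2 M G"
    using S R h y by (auto simp: bounded_op_def)
  have RS: "L2_eq M (R (S h)) h" and SR: "L2_eq M (S (R y)) y"
    using inv h y by (auto simp: is_bounded_inverse_def)
  show "L2_eq M h (R y)" if "L2_eq M (S h) y"
    using bounded_op_cong[OF R Sh y that] RS by (blast intro: L2_eq_sym L2_eq_trans)
  show "L2_eq M (S h) y" if "L2_eq M h (R y)"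
    using bounded_op_cong[OF S h Ry that] SR by (blast intro: L2_eq_trans)
qed

text \<open>Forward substitution for abstract operators. An off-diagonal \<open>S k l\<close> maps
  between different spaces, so its compatibility with a.e. equality is the premise
  \<open>cong\<close> instead of a consequence of \<open>bounded_op\<close>.\<close>

lemma triangular_system:
  fixes S :: "nat \<Rightarrow> nat \<Rightarrow> ('a \<Rightarrow> real ^ 'n) \<Rightarrow> ('a \<Rightarrow> real ^ 'n)"
    and y :: "nat \<Rightarrow> 'a \<Rightarrow> real ^ 'n"
  assumes P: "\<And>k. prob_subalgebra M (F k)"
    and inv: "\<And>k. k \<le> Tbar \<Longrightarrow> is_bounded_inverse M (F k) (S k k) (R k)"
    and off: "\<And>k l h. k \<le> Tbar \<Longrightarrow> l < k \<Longrightarrow> h \<in> L2 M (F l) \<Longrightarrow> S k l h \<in> L2 M (F k)"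
    and cong: "\<And>k l h h'. k \<le> Tbar \<Longrightarrow> l < k \<Longrightarrow> h \<in> L2 M (F l) \<Longrightarrow> h' \<in> L2 M (F l) \<Longrightarrow>
      L2_eq M h h' \<Longrightarrow> L2_eq M (S k l h) (S k l h')"
    and y: "\<And>k. k \<le> Tbar \<Longrightarrow> y k \<in> L2 M (F k)"
  defines "solves \<equiv> \<lambda>h. \<forall>k\<le>Tbar. L2_eq M (\<lambda>x. \<Sum>l\<in>{0..k}. S k l (h l) x) (y k)"
    and "succ \<equiv> \<lambda>h. \<forall>k\<le>Tbar. L2_eq M (h k) (R k (\<lambda>x. y k x - (\<Sum>l\<in>{0..<k}. S k l (h l) x)))"
  shows "\<And>h. h \<in> Hsum M F Tbar \<Longrightarrow> solves h \<longleftrightarrow> succ h"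
    and "\<exists>h\<in>Hsum M F Tbar. solves h \<and> (\<forall>h'\<in>Hsum M F Tbar. solves h' \<longrightarrow> Hsum_eq M Tbar h' h)"
proof -
  define rhs where "rhs = (\<lambda>h k x. y k x - (\<Sum>l\<in>{0..<k}. S k l (h l) x))"
  have rhs_L2: "rhs h k \<in> L2 M (F k)" if "k \<le> Tbar" "\<And>l. l < k \<Longrightarrow> h l \<in> L2 M (F l)" for h k
  proof -
    interpret prob_subalgebra M "F k" by (rule P)
    show ?thesis
      unfolding rhs_def using that by (intro L2_diff L2_sum y off) auto
  qed
  have R_bounded: "bounded_op M (F k) (R k)" if "k \<le> Tbar" for k
    using inv[OF that] by (simp add: is_bounded_inverse_def)
  have R_L2: "R k f \<in> L2 M (F k)" if "k \<le> Tbar" "f \<in> L2 M (F k)" for k f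
    using R_bounded[OF that(1)] that(2) by (simp add: bounded_op_def)
  show equiv: "solves h \<longleftrightarrow> succ h" if h: "h \<in> Hsum M F Tbar" for h
  proof -
    have "L2_eq M (\<lambda>x. \<Sum>l\<in>{0..k}. S k l (h l) x) (y k) \<longleftrightarrow> L2_eq M (h k) (R k (rhs h k))"
      if k: "k \<le> Tbar" for k
    proof -
      interpret prob_subalgebra M "F k" by (rule P)
      have "{0..k} = insert k {0..<k}" by auto
      then have "L2_eq M (\<lambda>x. \<Sum>l\<in>{0..k}. S k l (h l) x) (y k) \<longleftrightarrow> L2_eq M (S k k (h k)) (rhs h k)"
        by (simp add: L2_eq_def rhs_def algebra_simps)
      also have "\<dots> \<longleftrightarrow> L2_eq M (h k) (R k (rhs h k))"
        using h k by (intro bounded_inverse_solve inv rhs_L2) (auto simp: Hsum_def)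
      finally show ?thesis .
    qed
    then show ?thesis by (simp add: solves_def succ_def rhs_def)
  qed
  \<comment> \<open>The components are built with equality of functions, not merely a.e.;
    \<open>rhs h k\<close> reads only components below k, so extending \<open>h\<close> at m leaves
    the earlier equations intact.\<close>
  have "\<exists>h. \<forall>k<m. k \<le> Tbar \<longrightarrow> h k \<in> L2 M (F k) \<and> h k = R k (rhs h k)" for m
  proof (induction m)
    case (Suc m)
    then obtain h where h: "\<And>k. k < m \<Longrightarrow> k \<le> Tbar \<Longrightarrow> h k \<in> L2 M (F k) \<and> h k = R k (rhs h k)"
      by blast
    define h' where "h' = h(m := R m (rhs h m))"
    have rhs_h': "rhs h' k = rhs h k" if "k \<le> m" for k
      unfolding rhs_def h'_def using that by (intro ext arg_cong2[where f="(-)"] sum.cong) auto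
    have "h' k \<in> L2 M (F k) \<and> h' k = R k (rhs h' k)" if "k < Suc m" "k \<le> Tbar" for k
    proof (cases "k = m")
      case True
      have "R m (rhs h m) \<in> L2 M (F m)"
        using that True by (intro R_L2 rhs_L2 h[THEN conjunct1]) simp_all
      then show ?thesis
        using rhs_h'[of m] True by (simp add: h'_def)
    next
      case False
      with that have "k < m" by simp
      then have "h' k = h k" "rhs h' k = rhs h k"
        using rhs_h' by (simp_all add: h'_def)
      with h[OF \<open>k < m\<close> \<open>k \<le> Tbar\<close>] show ?thesis by metis
    qed
    then show ?case by blast
  qed simp
  from this[of "Suc Tbar"] obtain h
    where h: "\<And>k. k \<le> Tbar \<Longrightarrow> h k \<in> L2 M (F k) \<and> h k = R k (rhs h k)"
    by (auto simp: less_Suc_eq_le)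
  have h_L2: "h k \<in> L2 M (F k)" if "k \<le> Tbar" for k
    using h that by blast
  have hH: "h \<in> Hsum M F Tbar" using h_L2 by (auto simp: Hsum_def)
  have "succ h" using h by (auto simp: succ_def rhs_def L2_eq_def)
  then have "solves h" using equiv[OF hH] by simp
  moreover have "Hsum_eq M Tbar h' h" if h': "h' \<in> Hsum M F Tbar" and sol: "solves h'" for h'
  proof -
    have h'_succ: "L2_eq M (h' k) (R k (rhs h' k))" if "k \<le> Tbar" for k
      using equiv[OF h'] sol that by (simp add: succ_def rhs_def)
    have h'_L2: "h' k \<in> L2 M (F k)" if "k \<le> Tbar" for k
      using h' that by (auto simp: Hsum_def)
    have "k \<le> Tbar \<Longrightarrow> L2_eq M (h' k) (h k)" for k
    proof (induction k rule: less_induct)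
      case (less k)
      interpret prob_subalgebra M "F k" by (rule P)
      \<comment> \<open>The finitely many null sets from l < k combine into one, outside which both
        right-hand sides agree.\<close>
      have "AE x in M. \<forall>l\<in>{0..<k}. S k l (h' l) x = S k l (h l) x"
      proof (rule AE_finite_allI)
        fix l assume "l \<in> {0..<k}"
        then have "L2_eq M (S k l (h' l)) (S k l (h l))"
          using less h_L2 h'_L2 by (intro cong) auto
        then show "AE x in M. S k l (h' l) x = S k l (h l) x" by (simp add: L2_eq_def)
      qed simp
      then have "L2_eq M (rhs h' k) (rhs h k)"
        unfolding L2_eq_def rhs_def by eventually_elim simp
      moreover have "rhs h' k \<in> L2 M (F k)" "rhs h k \<in> L2 M (F k)"
        using less.prems h_L2 h'_L2 by (simp_all add: rhs_L2)
      ultimately have "L2_eq M (R k (rhs h' k)) (R k (rhs h k))"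
        using bounded_op_cong[OF R_bounded[OF less.prems]] by blast
      then show ?case
        by (subst h[OF less.prems, THEN conjunct2])
           (rule L2_eq_trans[OF h'_succ[OF less.prems]])
    qed
    then show ?thesis by (simp add: Hsum_eq_def)
  qed
  ultimately show "\<exists>h\<in>Hsum M F Tbar. solves h \<and>
      (\<forall>h'\<in>Hsum M F Tbar. solves h' \<longrightarrow> Hsum_eq M Tbar h' h)"
    using hH by blast
qed

lemma vec_cond_exp_cong:
  fixes f g :: "'a \<Rightarrow> real ^ 'n"
  assumes "prob_subalgebra M G"
    and eq: "L2_eq M f g" and f: "f \<in> borel_measurable M" and g: "g \<in> borel_measurable M"
  shows "L2_eq M (vec_cond_exp M G f) (vec_cond_exp M G g)"
proof -
  interpret prob_subalgebra M G by fact
  have "AE x in M. \<forall>i\<in>UNIV. real_cond_exp M G (\<lambda>y. f y $ i) x = real_cond_exp M G (\<lambda>y. g y $ i) x"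
  proof (rule AE_finite_allI)
    fix i
    show "AE x in M. real_cond_exp M G (\<lambda>y. f y $ i) x = real_cond_exp M G (\<lambda>y. g y $ i) x"
    proof (rule real_cond_exp_cong)
      show "AE x in M. f x $ i = g x $ i" using eq by (auto simp: L2_eq_def)
    qed (use f g borel_measurable_vec_iff in blast)+
  qed simp
  then show ?thesis by (simp add: L2_eq_def vec_cond_exp_def vec_eq_iff)
qed

lemma minus_matrix_mult_vec: "(- P) *v x = - (P *v x)" for P :: "real ^ 'm ^ 'k"
  by (simp add: vec_eq_iff matrix_vector_mult_def sum_negf)

section \<open>The operators C(k,l) and C^n(k,l) of the system\<close>

locale indep_system =
  fixes M :: "'a measure" and F :: "nat \<Rightarrow> 'a measure" and u :: "nat \<Rightarrow> 'a \<Rightarrow> real ^ 'n"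
    and Tbar :: nat
  assumes sub: "\<And>k. prob_subalgebra M (F k)"
    and indep: "\<And>k. k \<le> Tbar \<Longrightarrow> prob_subalgebra_indep M (F k) (u k)"
begin

text \<open>Both cases become one weight with a constant shift, so each property is proved once for
  A and B.\<close>

lemma C_op_eq:
  "C_op c M F u k l h = vec_cond_exp M (F k)
    (\<lambda>x. (u l x \<bullet> h x - (case c of OpA \<Rightarrow> 0 | OpB \<Rightarrow> (\<integral>y. u l y \<bullet> h y \<partial>M))) *\<^sub>R u k x)"
  by (cases c) (simp_all add: C_op_def A_op_def B_op_def)

lemma C_op_L2:
  assumes k: "k \<le> Tbar" and l: "l \<le> Tbar" and h: "h \<in> L2 M (F l)"
  shows "C_op c M F u k l h \<in> L2 M (F k)"
proof -
  interpret l: prob_subalgebra_indep M "F l" "u l" using indep[OF l] .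
  interpret k: prob_subalgebra_indep M "F k" "u k" using indep[OF k] .
  let ?w = "\<lambda>x. u l x \<bullet> h x" and ?a = "case c of OpA \<Rightarrow> 0 | OpB \<Rightarrow> (\<integral>y. u l y \<bullet> h y \<partial>M)"
  have [measurable]: "?w \<in> borel_measurable M" by (rule l.inner_L2(1)[OF h])
  have "integrable M (\<lambda>x. (?w x - ?a)\<^sup>2)"
  proof (rule Bochner_Integration.integrable_bound)
    show "integrable M (\<lambda>x. 2 * (?w x)\<^sup>2 + 2 * ?a\<^sup>2)"
      using l.inner_L2(2)[OF h] by simp
    show "AE x in M. norm ((?w x - ?a)\<^sup>2) \<le> norm (2 * (?w x)\<^sup>2 + 2 * ?a\<^sup>2)"
      using power2_norm_add_le[of "?w _" "- ?a"] by (intro AE_I2) simp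
  qed measurable
  then show ?thesis
    unfolding C_op_eq by (intro k.vec_cond_exp_scaleR_L2) measurable
qed

lemma C_op_cong:
  assumes k: "k \<le> Tbar" and l: "l \<le> Tbar" and h: "h \<in> L2 M (F l)" and h': "h' \<in> L2 M (F l)"
    and eq: "L2_eq M h h'"
  shows "L2_eq M (C_op c M F u k l h) (C_op c M F u k l h')"
proof -
  interpret l: prob_subalgebra_indep M "F l" "u l" using indep[OF l] .
  interpret k: prob_subalgebra_indep M "F k" "u k" using indep[OF k] .
  note [measurable] = l.inner_L2(1)[OF h] l.inner_L2(1)[OF h'] k.U_meas
  \<comment> \<open>In case B the shift depends on the argument, but only through an integral, which
    null sets do not change.\<close>
  have int: "(\<integral>y. u l y \<bullet> h y \<partial>M) = (\<integral>y. u l y \<bullet> h' y \<partial>M)"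
    by (rule integral_cong_AE) (use eq in \<open>auto simp: L2_eq_def\<close>)
  show ?thesis
    unfolding C_op_eq int
  proof (intro vec_cond_exp_cong[OF sub])
    show "L2_eq M
      (\<lambda>x. (u l x \<bullet> h x - (case c of OpA \<Rightarrow> 0 | OpB \<Rightarrow> (\<integral>y. u l y \<bullet> h' y \<partial>M))) *\<^sub>R u k x)
      (\<lambda>x. (u l x \<bullet> h' x - (case c of OpA \<Rightarrow> 0 | OpB \<Rightarrow> (\<integral>y. u l y \<bullet> h' y \<partial>M))) *\<^sub>R u k x)"
      using eq unfolding L2_eq_def by eventually_elim simp
  qed measurable
qed

text \<open>By independence E(u(k) . h) = E(u(k)) . E(h), so the correction of case B is a rank-one
  matrix applied to E(h).\<close>

lemma C_op_diag:
  assumes k: "k \<le> Tbar" and h: "h \<in> L2 M (F k)"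
  shows "AE x in M. C_op c M F u k k h x = Ma M u k *v h x -
    (case c of OpA \<Rightarrow> 0 | OpB \<Rightarrow> outer (mean_vec M u k) (mean_vec M u k) *v (\<integral>y. h y \<partial>M))"
proof -
  interpret prob_subalgebra_indep M "F k" "u k" using indep[OF k] .
  show ?thesis
    unfolding C_op_eq
    using vec_cond_exp_diag[OF h, of "case c of OpA \<Rightarrow> 0 | OpB \<Rightarrow> (\<integral>y. u k y \<bullet> h y \<partial>M)"]
      inner_L2(3)[OF h]
    by (cases c) (simp_all add: Ma_def mean_vec_def outer_mult_vec)
qed

lemma C_rec_offdiag_L2:
  assumes "k \<noteq> l" "k \<le> Tbar" "l \<le> Tbar" "h \<in> L2 M (F l)"
  shows "C_rec c M F u Tbar lam n k l h \<in> L2 M (F k)"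
proof -
  interpret prob_subalgebra M "F k" by (rule sub)
  obtain a where "C_rec c M F u Tbar lam n k l = (\<lambda>h x. a *\<^sub>R C_op c M F u k l h x)"
    using C_rec_offdiag[OF assms(1)] .
  then show ?thesis using L2_scaleR[OF C_op_L2[OF assms(2-4)]] by simp
qed

lemma C_rec_offdiag_cong:
  assumes "k \<noteq> l" "k \<le> Tbar" "l \<le> Tbar" "h \<in> L2 M (F l)" "h' \<in> L2 M (F l)" "L2_eq M h h'"
  shows "L2_eq M (C_rec c M F u Tbar lam n k l h) (C_rec c M F u Tbar lam n k l h')"
proof -
  obtain a where "C_rec c M F u Tbar lam n k l = (\<lambda>h x. a *\<^sub>R C_op c M F u k l h x)"
    using C_rec_offdiag[OF assms(1)] .
  then show ?thesis using C_op_cong[OF assms(2-6), of c] by (auto simp: L2_eq_def)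
qed

text \<open>The coefficient Q of E(h) in C^k(k,k); the coefficient P of h is D_k(k) in both
  cases.\<close>

definition mean_coeff :: "op_case \<Rightarrow> real \<Rightarrow> nat \<Rightarrow> real ^ 'n ^ 'n" where
  "mean_coeff c lam k = (case c of OpA \<Rightarrow> 0
    | OpB \<Rightarrow> - ((1 - rec_g M F u Tbar lam k) *\<^sub>R outer (mean_vec M u k) (mean_vec M u k)))"

text \<open>For k < Tbar this is the definition. At k = Tbar the conditional expectation is
  evaluated a.e., and g = 0 there gives the rank-one correction of case B its full weight.\<close>

lemma C_rec_diag:
  assumes k: "k \<le> Tbar" and h: "h \<in> L2 M (F k)"
  shows "L2_eq M (C_rec c M F u Tbar lam k k k h)
    (prob_subalgebra.mean_op M (rec_D M F u Tbar lam k k) (mean_coeff c lam k) h)"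
proof -
  interpret prob_subalgebra_indep M "F k" "u k" using indep[OF k] .
  show ?thesis
  proof (cases "k = Tbar")
    case True
    have rec: "AE x in M. C_rec c M F u Tbar lam k k k h x = C_op c M F u k k h x - lam *\<^sub>R h x"
      using True by (subst C_rec.simps) simp
    have D: "rec_D M F u Tbar lam k k = Ma M u k - mat lam"
      using True by (subst rec_D.simps) simp
    have g: "rec_g M F u Tbar lam k = 0"
      using True by (subst rec_g.simps) simp
    show ?thesis
      using rec C_op_diag[OF k h, of c] unfolding L2_eq_def
      by eventually_elim
        (cases c, simp_all add: mean_op_def mean_coeff_def D g matrix_vector_mult_diff_rdistrib
          mat_mult_vec minus_matrix_mult_vec)
  next
    case False
    then have "\<not> Tbar \<le> k" using k by simp
    then have "C_rec c M F u Tbar lam k k k h =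
      mean_op (rec_D M F u Tbar lam k k) (mean_coeff c lam k) h"
      by (subst C_rec.simps)
        (cases c, auto simp: fun_eq_iff mean_op_def mean_coeff_def outer_mult_vec
          minus_matrix_mult_vec scaleR_matrix_vector_assoc[symmetric])
    then show ?thesis by (simp add: L2_eq_def)
  qed
qed

text \<open>This does not follow from the a.e. identity, since a function a.e. equal to an
  F_k-measurable one may fail to be F_k-measurable.\<close>

lemma C_rec_diag_L2:
  assumes k: "k \<le> Tbar" and h: "h \<in> L2 M (F k)"
  shows "C_rec c M F u Tbar lam k k k h \<in> L2 M (F k)"
proof -
  interpret prob_subalgebra_indep M "F k" "u k" using indep[OF k] .
  show ?thesis
  proof (cases "k = Tbar")
    case True
    then have "C_rec c M F u Tbar lam k k k h = (\<lambda>x. C_op c M F u k k h x - lam *\<^sub>R h x)"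
      by (subst C_rec.simps) simp
    then show ?thesis using L2_diff[OF C_op_L2[OF k k h] L2_scaleR[OF h]] by simp
  next
    case False
    then have "\<not> Tbar \<le> k" using k by simp
    then have "C_rec c M F u Tbar lam k k k h =
      mean_op (rec_D M F u Tbar lam k k) (mean_coeff c lam k) h"
      by (subst C_rec.simps)
        (cases c, auto simp: fun_eq_iff mean_op_def mean_coeff_def outer_mult_vec
          minus_matrix_mult_vec scaleR_matrix_vector_assoc[symmetric])
    then show ?thesis using mean_op_L2[OF h] by simp
  qed
qed

lemma Mb_eq:
  assumes k: "k \<le> Tbar"
  shows "Mb M u k = Ma M u k - outer (mean_vec M u k) (mean_vec M u k)"
proof -
  interpret prob_subalgebra_indep M "F k" "u k" using indep[OF k] .
  have "expectation (\<lambda>x. (u k x $ i - a) * (u k x $ j - b)) =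
      expectation (\<lambda>x. u k x $ i * u k x $ j) - b * expectation (\<lambda>x. u k x $ i) -
      a * expectation (\<lambda>x. u k x $ j) + a * b" for i j a b
  proof -
    have "expectation (\<lambda>x. (u k x $ i - a) * (u k x $ j - b)) =
      expectation (\<lambda>x. u k x $ i * u k x $ j - b * u k x $ i - a * u k x $ j + a * b)"
      by (simp add: algebra_simps)
    then show ?thesis
      using U_nth_integrable(1) U_nth_mult_integrable by (simp add: prob_space)
  qed
  then show ?thesis
    by (simp add: vec_eq_iff Mb_def Ma_def outer_def mean_vec_def integral_vec_nth[OF U_integrable] mult.commute)
qed

lemma Nb_eq:
  assumes k: "k \<le> Tbar"
  shows "Nb M F u r k = Na M F u r k - outer (mean_vec M u k) (mean_vec M u k)"
proof -
  interpret prob_subalgebra_indep M "F k" "u k" using indep[OF k] .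
  show ?thesis
    by (simp add: vec_eq_iff Nb_def outer_def mean_vec_def integral_vec_nth[OF U_integrable])
qed

section \<open>Parameters outside the exceptional set\<close>

context
  fixes c :: op_case and lam :: real
  assumes lam: "lam \<notin> sigma_exc c M F u Tbar 0"
begin

lemma invertible_rec_D:
  assumes "n \<le> Tbar"
  shows "invertible (rec_D M F u Tbar lam n n)"
proof -
  have "lam \<notin> sigma_a M F u Tbar 0"
  proof (cases c)
    case OpA
    then show ?thesis using lam by (simp add: sigma_exc_def)
  next
    case OpB
    \<comment> \<open>Case B also rests on the matrices D_n(n), which is why \<open>sigma_b\<close>
      contains \<open>sigma_a\<close>.\<close>
    have "sigma_a M F u Tbar 0 \<subseteq> sigma_b M F u Tbar 0"
      by (subst sigma_b.simps) auto
    then show ?thesis using OpB lam by (auto simp: sigma_exc_def)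
  qed
  then have "lam \<notin> sigma_a M F u Tbar n"
    using sigma_a_antimono[of 0 n M F u Tbar] by auto
  then show ?thesis using assms by (rule invertible_rec_D_sigma_a)
qed

lemma C_rec_diag_has_bounded_inverse:
  assumes k: "k \<le> Tbar"
  shows "has_bounded_inverse M (F k) (C_rec c M F u Tbar lam k k k)"
proof -
  interpret prob_subalgebra M "F k" by (rule sub)
  have "invertible (rec_D M F u Tbar lam k k + mean_coeff c lam k)"
  proof (cases c)
    case OpA
    then show ?thesis using invertible_rec_D[OF k] by (simp add: mean_coeff_def)
  next
    case OpB
    then have "lam \<notin> sigma_b M F u Tbar k"
      using lam sigma_b_antimono[of 0 k M F u Tbar] by (auto simp: sigma_exc_def)
    from invertible_rec_D_sigma_b[OF this k Mb_eq[OF k] Nb_eq[OF k]] show ?thesis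
      using OpB by (simp add: mean_coeff_def)
  qed
  with C_rec_diag_L2[OF k] C_rec_diag[OF k] invertible_rec_D[OF k] show ?thesis
    by (rule has_bounded_inverse_AE_mean_op)
qed

lemma op_inverse_C_rec:
  assumes "k \<le> Tbar"
  shows "is_bounded_inverse M (F k) (C_rec c M F u Tbar lam k k k)
    (op_inverse M (F k) (C_rec c M F u Tbar lam k k k))"
  using prob_subalgebra.is_bounded_inverse_op_inverse[OF sub C_rec_diag_has_bounded_inverse[OF assms]] .

text \<open>The step from n + 1 to n inverts C^(n+1)(n+1,n+1), again one of the invertible diagonal
  operators, and then applies C^(n+1)(k,n+1) with k \<le> n, an off-diagonal entry.\<close>

lemma xi_rec_L2:
  assumes xi: "xi \<in> Hsum M F Tbar" and "n \<le> Tbar"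
  shows "k \<le> Tbar \<Longrightarrow> xi_rec c M F u Tbar lam xi n k \<in> L2 M (F k)"
  using \<open>n \<le> Tbar\<close>
proof (induction arbitrary: k rule: inc_induct)
  case base
  then show ?case using xi by (subst xi_rec.simps) (auto simp: Hsum_def)
next
  case (step n)
  interpret prob_subalgebra M "F k" by (rule sub)
  have n: "\<not> Tbar \<le> n" using step.hyps by simp
  show ?case
  proof (cases "n < k")
    case True
    then show ?thesis using n step by (subst xi_rec.simps) simp
  next
    case False
    let ?S = "C_rec c M F u Tbar lam (Suc n) (Suc n) (Suc n)"
    have "op_inverse M (F (Suc n)) ?S (xi_rec c M F u Tbar lam xi (Suc n) (Suc n)) \<in> L2 M (F (Suc n))"
      using op_inverse_C_rec[of "Suc n"] step n
      by (simp add: is_bounded_inverse_def bounded_op_def)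
    then show ?thesis
      using n False step by (subst xi_rec.simps) (auto intro!: L2_diff C_rec_offdiag_L2)
  qed
qed

end

end

theorem propositionA4:
  fixes M :: "'a measure"
    and F :: "nat \<Rightarrow> 'a measure"
    and u :: "nat \<Rightarrow> 'a \<Rightarrow> real ^ 'n"
    and Tbar T :: nat
    and lam :: real
    and c :: op_case
    and xi :: "nat \<Rightarrow> 'a \<Rightarrow> real ^ 'n"
  assumes prob: "prob_space M"
    and sub: "\<And>t. subalgebra M (F t)"
    and filt: "filtration (space M) F"
    and F0: "sets (F 0) = {{}, space M}"
    and Tbar: "1 \<le> Tbar"
    and meas: "\<And>k. k \<le> Tbar \<Longrightarrow> u k \<in> borel_measurable (F (Tbar + T))"
    and moments: "\<And>k p. k \<le> Tbar \<Longrightarrow> integrable M (\<lambda>x. norm (u k x) ^ (p::nat))"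
    and H1: "\<And>k. k \<le> Tbar \<Longrightarrow>
               prob_space.indep_set M (sets (F k)) (sets (vimage_algebra (space M) (u k) borel))"
    and H2: "\<And>k. k \<le> Tbar \<Longrightarrow> pos_definite (Mb M u k)"
    and H3: "\<And>i j k l. k \<le> Tbar \<Longrightarrow> l \<le> Tbar \<Longrightarrow> k \<noteq> l \<Longrightarrow>
               prob_space.indep_var M borel (\<lambda>x. u k x $ i) borel (\<lambda>x. u l x $ j)"
    and xi: "xi \<in> Hsum M F Tbar"
    and lam: "lam \<notin> sigma_exc c M F u Tbar 0"
  shows
    "(\<forall>n\<le>Tbar. invertible (rec_D M F u Tbar lam n n)) \<and>
     (\<forall>k\<le>Tbar. has_bounded_inverse M (F k) (C_rec c M F u Tbar lam k k k)) \<and>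
     (\<exists>h\<in>Hsum M F Tbar. solves_triangular c M F u Tbar lam xi h \<and>
        (\<forall>h'\<in>Hsum M F Tbar. solves_triangular c M F u Tbar lam xi h' \<longrightarrow> Hsum_eq M Tbar h' h)) \<and>
     (\<forall>h\<in>Hsum M F Tbar.
        solves_triangular c M F u Tbar lam xi h \<longleftrightarrow> given_successively c M F u Tbar lam xi h)"
proof -
  have P: "prob_subalgebra M (F k)" for k
    using prob sub[of k]
    by (simp add: prob_subalgebra_def finite_measure_subalgebra_def
        finite_measure_subalgebra_axioms_def prob_space.finite_measure)
  have I: "prob_subalgebra_indep M (F k) (u k)" if "k \<le> Tbar" for k
    unfolding prob_subalgebra_indep_def prob_subalgebra_indep_axioms_def
    using P H1[OF that] moments[OF that] measurable_from_subalg[OF sub meas[OF that]] by blast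
  interpret indep_system M F u Tbar
    by (rule indep_system.intro) (use P I in auto)
  let ?S = "C_rec c M F u Tbar lam 0" and ?R = "\<lambda>k. op_inverse M (F k) (C_rec c M F u Tbar lam k k k)"
    and ?y = "xi_rec c M F u Tbar lam xi 0"
  \<comment> \<open>The system contains C^0(k,k), the formula inverts C^k(k,k); the two coincide
    because row k is frozen below stage k.\<close>
  have inv: "is_bounded_inverse M (F k) (?S k k) (?R k)" if "k \<le> Tbar" for k
    using op_inverse_C_rec[OF lam that] C_rec_0_eq[OF that, of c M F u lam k] by simp
  have off: "?S k l h \<in> L2 M (F k)" if "k \<le> Tbar" "l < k" "h \<in> L2 M (F l)" for k l h
    using that by (intro C_rec_offdiag_L2) auto
  have cong: "L2_eq M (?S k l h) (?S k l h')"
    if "k \<le> Tbar" "l < k" "h \<in> L2 M (F l)" "h' \<in> L2 M (F l)" "L2_eq M h h'" for k l h h'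
    using that by (intro C_rec_offdiag_cong) auto
  have y: "?y k \<in> L2 M (F k)" if "k \<le> Tbar" for k
    using xi_rec_L2[OF lam xi _ that] by simp
  note triangular = triangular_system[where S="?S" and R="?R" and y="?y", OF P inv off cong y]
  show ?thesis
    unfolding solves_triangular_def given_successively_def
    using invertible_rec_D[OF lam] C_rec_diag_has_bounded_inverse[OF lam] triangular
    by simp
qed

end
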